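(* Let $f=(f_1,\ldots,f_m)\colon\mathbb{R}^n\to\mathbb{R}^m$ be a polynomial map, and let $\mathrm{val}$ and $\mathrm{val}^w$ denote the sets of Pareto values and of weak Pareto values, respectively, of the problem $\mathrm{Min}_{\,\mathbb{R}^m_+}\{f(x)\mid x\in\mathbb{R}^n\}$. Then $$\mathrm{val}\subset \mathrm{val}^w\subset K_0(f)\cup T_\infty(f).$$ In particular, the semi-algebraic sets $\mathrm{val}$ and $\mathrm{val}^w$ are of dimension at most $m-1$.
   Context: $n,m\ge 1$; $\mathbb{R}^m_+$ is the nonnegative orthant and $\operatorname{int}\mathbb{R}^m_+$ its interior; $\mathrm{cl}$ denotes closure. A point $t\in\mathrm{cl}\,f(\mathbb{R}^n)$ is a Pareto value if $f(x)\notin t-(\mathbb{R}^m_+\setminus\{0\})$ for all $x\in\mathbb{R}^n$. A point $t\in\mathrm{cl}\,f(\mathbb{R}^n)$ is a weak Pareto value if $f(x)\notin t-\operatorname{int}\mathbb{R}^m_+$ for all $x\in\mathbb{R}^n$. (These values need not belong to $f(\mathbb{R}^n)$.) $K_0(f)$ is the set of critical values of $f$: $t\in K_0(f)$ iff there is $x\in f^{-1}(t)$ such that the derivative $Df(x)\colon\mathbb{R}^n\to\mathbb{R}^m$ is not surjective. The tangency variety of $f$ is $$\Gamma(f)=\Big\{x\in\mathbb{R}^n\ \Big|\ \exists\,\lambda_1,\ldots,\lambda_m,\mu\in\mathbb{R}\text{ not all zero with }\sum_{i=1}^m\lambda_i\nabla f_i(x)+\mu x=0\Big\}.$$ The set of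 tangency values at infinity is $$T_\infty(f)=\{t\in\mathbb{R}^m\mid\exists\{x^k\}\subset\Gamma(f),\ \|x^k\|\to+\infty,\ f(x^k)\to t\text{ as }k\to\infty\}.$$ A subset of $\mathbb{R}^m$ is semi-algebraic if it is a finite union of sets defined by finitely many polynomial equations and strict polynomial inequalities. The dimension of a nonempty semi-algebraic set is the largest dimension of a manifold in a decomposition of it into finitely many disjoint semi-algebraic $C^p$-manifolds; the empty set has dimension $-\infty$. *)

theory Defs
  imports "HOL-Analysis.Analysis"
begin

subsection \<open>Pareto values\<close>

definition nonneg_orthant :: "(real ^ 'm) set" where
  "nonneg_orthant = {v. \<forall>i. 0 \<le> v $ i}"

definition pareto_values :: "('a \<Rightarrow> real ^ 'm) \<Rightarrow> (real ^ 'm) set" where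
  "pareto_values f =
     {t \<in> closure (range f). \<forall>x. f x \<notin> (\<lambda>v. t - v) ` (nonneg_orthant - {0})}"

definition weak_pareto_values :: "('a \<Rightarrow> real ^ 'm) \<Rightarrow> (real ^ 'm) set" where
  "weak_pareto_values f =
     {t \<in> closure (range f). \<forall>x. f x \<notin> (\<lambda>v. t - v) ` interior nonneg_orthant}"

subsection \<open>Critical values and tangency values at infinity\<close>

definition critical_values :: "(real ^ 'n \<Rightarrow> real ^ 'm) \<Rightarrow> (real ^ 'm) set" where
  "critical_values f = {t. \<exists>x. f x = t \<and> \<not> surj (frechet_derivative f (at x))}"

definition gradient :: "('a::real_inner \<Rightarrow> real) \<Rightarrow> 'a \<Rightarrow> 'a" where
  "gradient g x = (THE D. GDERIV g x :> D)"

definition tangency_variety :: "(real ^ 'n \<Rightarrow> real ^ 'm) \<Rightarrow> (real ^ 'n) set" where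
  "tangency_variety f =
     {x. \<exists>(l :: 'm \<Rightarrow> real) (\<mu> :: real). \<not> ((\<forall>i. l i = 0) \<and> \<mu> = 0) \<and>
           (\<Sum>i\<in>UNIV. l i *\<^sub>R gradient (\<lambda>y. f y $ i) x) + \<mu> *\<^sub>R x = 0}"

definition tangency_values_at_infinity ::
    "(real ^ 'n \<Rightarrow> real ^ 'm) \<Rightarrow> (real ^ 'm) set" where
  "tangency_values_at_infinity f =
     {t. \<exists>xs :: nat \<Rightarrow> real ^ 'n. (\<forall>k. xs k \<in> tangency_variety f) \<and>
           filterlim (\<lambda>k. norm (xs k)) at_top sequentially \<and>
           (\<lambda>k. f (xs k)) \<longlonglongrightarrow> t}"

subsection \<open>Semi-algebraic sets and their dimension\<close>

definition basic_semialgebraic :: "'a::euclidean_space set \<Rightarrow> bool" where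
  "basic_semialgebraic S \<longleftrightarrow>
     (\<exists>P Q. finite P \<and> finite Q \<and>
        (\<forall>g\<in>P \<union> Q. real_polynomial_function g) \<and>
        S = {x. (\<forall>g\<in>P. g x = 0) \<and> (\<forall>g\<in>Q. g x > 0)})"

definition semialgebraic :: "'a::euclidean_space set \<Rightarrow> bool" where
  "semialgebraic S \<longleftrightarrow>
     (\<exists>\<F>. finite \<F> \<and> (\<forall>B\<in>\<F>. basic_semialgebraic B) \<and> S = \<Union>\<F>)"

text \<open>
  \<open>Ck_on k f U\<close> is meant for open \<open>U\<close>.  In finite dimension the map
  \<open>x \<mapsto> Df(x)\<close> is of class \<open>C\<^sup>k\<close> iff \<open>x \<mapsto> Df(x) v\<close> is so for
  every fixed vector \<open>v\<close>.
\<close>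
primrec Ck_on ::
    "nat \<Rightarrow> ('a::euclidean_space \<Rightarrow> 'b::euclidean_space) \<Rightarrow> 'a set \<Rightarrow> bool" where
  "Ck_on 0 f U \<longleftrightarrow> continuous_on U f"
| "Ck_on (Suc k) f U \<longleftrightarrow>
     (\<forall>x\<in>U. f differentiable (at x)) \<and>
     (\<forall>v. Ck_on k (\<lambda>x. frechet_derivative f (at x) v) U)"

text \<open>
  Embedded \<open>d\<close>-dimensional \<open>C\<^sup>p\<close> submanifolds: locally, a \<open>C\<^sup>p\<close> diffeomorphism of open
  sets of the ambient space flattens \<open>M\<close> to a \<open>d\<close>-dimensional linear subspace.
\<close>
definition Cp_submanifold :: "nat \<Rightarrow> nat \<Rightarrow> 'a::euclidean_space set \<Rightarrow> bool" where
  "Cp_submanifold p d M \<longleftrightarrow>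
     (\<forall>x\<in>M. \<exists>(U :: 'a set) (V :: 'a set) (\<phi> :: 'a \<Rightarrow> 'a) (\<psi> :: 'a \<Rightarrow> 'a) (L :: 'a set).
        open U \<and> x \<in> U \<and> open V \<and> homeomorphism U V \<phi> \<psi> \<and>
        Ck_on p \<phi> U \<and> Ck_on p \<psi> V \<and>
        subspace L \<and> dim L = d \<and> \<phi> ` (M \<inter> U) = V \<inter> L)"

text \<open>The pieces of a partition are nonempty, so each of them has a unique dimension.\<close>
definition semialgebraic_decomposition ::
    "nat \<Rightarrow> 'a::euclidean_space set \<Rightarrow> 'a set set \<Rightarrow> bool" where
  "semialgebraic_decomposition p S \<M> \<longleftrightarrow>
     finite \<M> \<and> partition_on S \<M> \<and>
     (\<forall>M\<in>\<M>. semialgebraic M \<and> (\<exists>d. Cp_submanifold p d M))"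

text \<open>
  Every semi-algebraic set has such a decomposition, and the largest dimension of a piece is
  the same for all of its decompositions, so for semi-algebraic sets the supremum is that common
  value.  The only partition of the empty set is the empty one, so its dimension is
  \<open>Sup {} = -\<infinity>\<close>.
\<close>
definition semialgebraic_dim :: "nat \<Rightarrow> 'a::euclidean_space set \<Rightarrow> ereal" where
  "semialgebraic_dim p S =
     Sup {ereal (real d) | d M \<M>. semialgebraic_decomposition p S \<M> \<and> M \<in> \<M> \<and> Cp_submanifold p d M}"

end

theory Submission
  imports Defs "HOL-Computational_Algebra.Polynomial"
begin

text \<open>
  A weak Pareto value \<open>t = f x\<close> is critical, since \<open>f\<close> is open at \<open>x\<close> when \<open>Df(x)\<close> is onto and then takes
  values below \<open>t\<close> in every component.  If \<open>t\<close> is not attained, it is the limit of \<open>f\<close> along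
  minimisers of the squared distance \<open>\<parallel>f y - t\<parallel>\<^sup>2\<close> on larger and larger spheres, and these lie in the tangency
  variety.  The weak Pareto values have empty interior, because \<open>t\<close> and a point above it in every
  component are not both weak Pareto values; so no full-dimensional manifold fits into them.

  Semi-algebraicity is quantifier elimination.  A condition is constructible over an algebra \<open>A\<close> of real
  functions if it is a Boolean combination of conditions \<open>g > 0\<close> with \<open>g \<in> A\<close>.  By induction on the degree,
  functions selecting all the roots of a polynomial with coefficients in \<open>A\<close> can be adjoined to \<open>A\<close> without
  enlarging the class of constructible conditions: roots are isolated by those of the derivative, and signs
  at a root are determined through remainders of lower degree.  In the enlarged algebra, a quantifier over
  one real variable becomes a finite disjunction over test points taken at, between and outside the roots.
\<close>

subsection \<open>Real polynomials\<close>

lemma poly_pos_interval: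
  fixes p :: "real poly"
  assumes "\<And>z. l < z \<Longrightarrow> z < u \<Longrightarrow> poly p z \<noteq> 0"
    and "l < x" "x < u" "l < y" "y < u" and "poly p x > 0"
  shows "poly p y > 0"
proof (rule ccontr)
  assume "\<not> ?thesis"
  moreover have "poly p y \<noteq> 0" using assms by blast
  ultimately have n: "poly p y < 0" by linarith
  have "x \<noteq> y" using n assms by auto
  then consider "x < y" | "y < x" by linarith
  then show False
  proof cases
    case 1
    then obtain z where "x < z" "z < y" "poly p z = 0" using poly_IVT_neg[of x y p] n assms by auto
    then show False using assms(1)[of z] assms by auto
  next
    case 2
    then obtain z where "y < z" "z < x" "poly p z = 0" using poly_IVT_pos[of y x p] n assms by auto
    then show False using assms(1)[of z] assms by auto
  qed
qed

text \<open>The derivative keeps one sign inside the interval, and the mean value theorem evaluates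
  it only there. Hence monotonicity reaches the endpoints, where the derivative may vanish.\<close>

lemma poly_strict_mono_interval:
  fixes p :: "real poly"
  assumes "\<And>z. l < z \<Longrightarrow> z < u \<Longrightarrow> poly (pderiv p) z \<noteq> 0"
  shows "(\<forall>x y. l \<le> x \<longrightarrow> x < y \<longrightarrow> y \<le> u \<longrightarrow> poly p x < poly p y) \<or>
         (\<forall>x y. l \<le> x \<longrightarrow> x < y \<longrightarrow> y \<le> u \<longrightarrow> poly p y < poly p x)"
proof (cases "\<exists>z. l < z \<and> z < u \<and> poly (pderiv p) z > 0")
  case True
  then obtain z where z: "l < z" "z < u" "poly (pderiv p) z > 0" by blast
  have pos: "poly (pderiv p) w > 0" if "l < w" "w < u" for w
    using poly_pos_interval[OF assms] z that by blast
  have "poly p x < poly p y" if "l \<le> x" "x < y" "y \<le> u" for x y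
  proof -
    obtain w where w: "x < w" "w < y" "poly p y - poly p x = (y - x) * poly (pderiv p) w"
      using poly_MVT[OF \<open>x < y\<close>, of p] by blast
    have "(y - x) * poly (pderiv p) w > 0" using pos[of w] w that by simp
    then show ?thesis using w by simp
  qed
  then show ?thesis by blast
next
  case False
  have neg: "poly (pderiv p) w < 0" if "l < w" "w < u" for w
    using False assms[of w] that by (meson linorder_neqE)
  have "poly p y < poly p x" if "l \<le> x" "x < y" "y \<le> u" for x y
  proof -
    obtain w where w: "x < w" "w < y" "poly p y - poly p x = (y - x) * poly (pderiv p) w"
      using poly_MVT[OF \<open>x < y\<close>, of p] by blast
    have "(y - x) * poly (pderiv p) w < 0"
      using neg[of w] w that by (intro mult_pos_neg) auto
    then show ?thesis using w by simp
  qed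
  then show ?thesis by blast
qed

text \<open>A comparison with an unknown root becomes a sign condition at the known point
  \<open>z\<close>. Multiplying by the value at an endpoint makes the criterion the same for
  increasing and decreasing \<open>p\<close>.\<close>

lemma poly_sign_change_iff:
  fixes p :: "real poly"
  assumes "\<And>z. l < z \<Longrightarrow> z < u \<Longrightarrow> poly (pderiv p) z \<noteq> 0"
    and "l < x" "x < u" "poly p x = 0"
  shows "poly p l * poly p u < 0"
    and "l < z \<Longrightarrow> z < u \<Longrightarrow> z < x \<longleftrightarrow> poly p z * poly p l > 0"
    and "l < z \<Longrightarrow> z < u \<Longrightarrow> x < z \<longleftrightarrow> poly p z * poly p u > 0"
proof -
  let ?P = "\<lambda>x y. l \<le> x \<longrightarrow> x < y \<longrightarrow> y \<le> u \<longrightarrow> poly p x < poly p y"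
  let ?N = "\<lambda>x y. l \<le> x \<longrightarrow> x < y \<longrightarrow> y \<le> u \<longrightarrow> poly p y < poly p x"
  have m: "(\<forall>x y. ?P x y) \<or> (\<forall>x y. ?N x y)"
    by (rule poly_strict_mono_interval) fact
  show "poly p l * poly p u < 0"
    using m assms(2-4) by (smt (verit) mult_neg_pos mult_pos_neg)
  show "z < x \<longleftrightarrow> poly p z * poly p l > 0" if "l < z" "z < u"
    using m
  proof
    assume "\<forall>x y. ?P x y"
    then have "poly p l < 0" "z < x \<longrightarrow> poly p z < 0" "x < z \<longrightarrow> poly p z > 0"
      using assms(2-4) that by (metis less_eq_real_def)+
    then show ?thesis using assms(4) by (smt (verit) mult_neg_neg zero_less_mult_pos2 mult_nonneg_nonpos)
  next
    assume "\<forall>x y. ?N x y"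
    then have "poly p l > 0" "z < x \<longrightarrow> poly p z > 0" "x < z \<longrightarrow> poly p z < 0"
      using assms(2-4) that by (metis less_eq_real_def)+
    then show ?thesis using assms(4) by (smt (verit) mult_pos_pos zero_less_mult_pos2 mult_nonneg_nonpos)
  qed
  show "x < z \<longleftrightarrow> poly p z * poly p u > 0" if "l < z" "z < u"
    using m
  proof
    assume "\<forall>x y. ?P x y"
    then have "poly p u > 0" "z < x \<longrightarrow> poly p z < 0" "x < z \<longrightarrow> poly p z > 0"
      using assms(2-4) that by (metis less_eq_real_def)+
    then show ?thesis using assms(4) by (smt (verit) mult_pos_pos zero_less_mult_pos2 mult_nonneg_nonpos)
  next
    assume "\<forall>x y. ?N x y"
    then have "poly p u < 0" "z < x \<longrightarrow> poly p z > 0" "x < z \<longrightarrow> poly p z < 0"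
      using assms(2-4) that by (metis less_eq_real_def)+
    then show ?thesis using assms(4) by (smt (verit) mult_neg_neg zero_less_mult_pos2 mult_nonneg_nonpos)
  qed
qed

lemma poly_eq_sum_coeff:
  fixes p :: "'a::comm_semiring_1 poly"
  assumes "degree p \<le> N"
  shows "poly p x = (\<Sum>i\<le>N. coeff p i * x ^ i)"
  unfolding poly_altdef
  by (rule sum.mono_neutral_left) (use assms in \<open>auto simp: coeff_eq_0\<close>)

text \<open>At a root beyond this bound the leading power would exceed the sum of the other terms.
  Squares instead of absolute values make the bound a polynomial in the coefficients, so that it
  lies in the algebra containing them.\<close>

lemma monic_root_bound:
  fixes p :: "real poly"
  assumes "degree p = Suc d" "coeff p (Suc d) = 1" "poly p x = 0"
  shows "\<bar>x\<bar> < 2 + (\<Sum>i\<le>d. (coeff p i)\<^sup>2 + 1)"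
proof (rule ccontr)
  let ?S = "\<Sum>i\<le>d. (coeff p i)\<^sup>2 + 1"
  assume "\<not> ?thesis"
  then have big: "\<bar>x\<bar> \<ge> 2 + ?S" by simp
  have S0: "?S \<ge> 0" by (intro sum_nonneg) auto
  have ab: "\<bar>c\<bar> \<le> c\<^sup>2 + 1" for c :: real
  proof -
    have "0 \<le> (\<bar>c\<bar> - 1)\<^sup>2" by simp
    then have "2 * \<bar>c\<bar> \<le> c\<^sup>2 + 1" by (simp add: power2_diff)
    then show ?thesis by linarith
  qed
  have x1: "\<bar>x\<bar> \<ge> 1" using big S0 by linarith
  have "x ^ Suc d = - (\<Sum>i\<le>d. coeff p i * x ^ i)"
    using assms poly_eq_sum_coeff[of p "Suc d" x] by (simp add: add_eq_0_iff)
  then have "\<bar>x\<bar> ^ Suc d = \<bar>\<Sum>i\<le>d. coeff p i * x ^ i\<bar>"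
    by (metis abs_minus_cancel power_abs)
  also have "\<dots> \<le> (\<Sum>i\<le>d. \<bar>coeff p i * x ^ i\<bar>)" by (rule sum_abs)
  also have "\<dots> \<le> (\<Sum>i\<le>d. ((coeff p i)\<^sup>2 + 1) * \<bar>x\<bar> ^ d)"
    by (intro sum_mono) (auto simp: abs_mult power_abs intro!: mult_mono ab power_increasing x1)
  also have "\<dots> = ?S * \<bar>x\<bar> ^ d" by (simp add: sum_distrib_right)
  also have "\<dots> < \<bar>x\<bar> * \<bar>x\<bar> ^ d"
    using big x1 by (intro mult_strict_right_mono) auto
  finally show False by simp
qed

subsection \<open>Algebras of functions and constructible conditions\<close>

definition fun_algebra :: "('a \<Rightarrow> real) set \<Rightarrow> bool" where
  "fun_algebra A \<longleftrightarrow> (\<forall>c. (\<lambda>_. c) \<in> A) \<and>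
     (\<forall>f\<in>A. \<forall>g\<in>A. (\<lambda>a. f a + g a) \<in> A \<and> (\<lambda>a. f a * g a) \<in> A)"

lemma fun_algebraD:
  assumes "fun_algebra A"
  shows "(\<lambda>_. c) \<in> A"
    and "f \<in> A \<Longrightarrow> g \<in> A \<Longrightarrow> (\<lambda>a. f a + g a) \<in> A"
    and "f \<in> A \<Longrightarrow> g \<in> A \<Longrightarrow> (\<lambda>a. f a * g a) \<in> A"
  using assms unfolding fun_algebra_def by auto

lemma fun_algebra_diff:
  assumes "fun_algebra A" "f \<in> A" "g \<in> A"
  shows "(\<lambda>a. f a - g a) \<in> A"
  using fun_algebraD(2)[OF assms(1,2) fun_algebraD(3)[OF assms(1) fun_algebraD(1)[OF assms(1), of "-1"] assms(3)]]
  by simp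

lemma fun_algebra_uminus:
  assumes "fun_algebra A" "f \<in> A"
  shows "(\<lambda>a. - f a) \<in> A"
  using fun_algebra_diff[OF assms(1) fun_algebraD(1)[OF assms(1), of 0] assms(2)] by simp

lemma fun_algebra_power:
  assumes "fun_algebra A" "f \<in> A"
  shows "(\<lambda>a. f a ^ k) \<in> A"
  by (induction k) (use assms in \<open>auto intro: fun_algebraD\<close>)

lemma fun_algebra_sum:
  assumes "fun_algebra A" "finite I" "\<And>i. i \<in> I \<Longrightarrow> f i \<in> A"
  shows "(\<lambda>a. \<Sum>i\<in>I. f i a) \<in> A"
  using assms(2,3) by (induction I) (auto intro: fun_algebraD[OF assms(1)])

lemmas fun_algebra_intros = fun_algebraD fun_algebra_diff fun_algebra_uminus fun_algebra_power fun_algebra_sum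

inductive constructible :: "('a \<Rightarrow> real) set \<Rightarrow> ('a \<Rightarrow> bool) \<Rightarrow> bool" for A where
  pos: "g \<in> A \<Longrightarrow> constructible A (\<lambda>a. 0 < g a)"
| neg: "constructible A \<phi> \<Longrightarrow> constructible A (\<lambda>a. \<not> \<phi> a)"
| conj: "constructible A \<phi> \<Longrightarrow> constructible A \<psi> \<Longrightarrow> constructible A (\<lambda>a. \<phi> a \<and> \<psi> a)"

lemma constructible_disj:
  assumes "constructible A \<phi>" "constructible A \<psi>"
  shows "constructible A (\<lambda>a. \<phi> a \<or> \<psi> a)"
proof -
  have "constructible A (\<lambda>a. \<not> (\<not> \<phi> a \<and> \<not> \<psi> a))"
    by (intro constructible.neg constructible.conj assms)
  then show ?thesis by simp
qed

lemma constructible_imp: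
  assumes "constructible A \<phi>" "constructible A \<psi>"
  shows "constructible A (\<lambda>a. \<phi> a \<longrightarrow> \<psi> a)"
  using constructible_disj[OF constructible.neg[OF assms(1)] assms(2)] by (simp only: imp_conv_disj)

lemma constructible_const:
  assumes "fun_algebra A" shows "constructible A (\<lambda>_. b)"
proof -
  have "constructible A (\<lambda>_. 0 < (1::real))" "constructible A (\<lambda>_. 0 < (0::real))"
    by (rule constructible.pos, rule fun_algebraD, rule assms)+
  then show ?thesis by (cases b) auto
qed

lemma constructible_less:
  assumes "fun_algebra A" "f \<in> A" "g \<in> A"
  shows "constructible A (\<lambda>a. f a < g a)"
  using constructible.pos[OF fun_algebra_diff[OF assms(1,3,2)]] by simp

lemma constructible_le:
  assumes "fun_algebra A" "f \<in> A" "g \<in> A"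
  shows "constructible A (\<lambda>a. f a \<le> g a)"
  using constructible.neg[OF constructible_less[OF assms(1,3,2)]] by (simp add: not_less)

lemma constructible_eq:
  assumes "fun_algebra A" "f \<in> A" "g \<in> A"
  shows "constructible A (\<lambda>a. f a = g a)"
  using constructible.conj[OF constructible_le[OF assms] constructible_le[OF assms(1,3,2)]]
  by (simp add: eq_iff)

lemma constructible_ball:
  assumes "fun_algebra A" "finite I" "\<And>i. i \<in> I \<Longrightarrow> constructible A (\<phi> i)"
  shows "constructible A (\<lambda>a. \<forall>i\<in>I. \<phi> i a)"
  using assms(2,3)
  by (induction I) (auto intro: constructible.intros constructible_const[OF assms(1)])

lemma constructible_bex:
  assumes "fun_algebra A" "finite I" "\<And>i. i \<in> I \<Longrightarrow> constructible A (\<phi> i)"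
  shows "constructible A (\<lambda>a. \<exists>i\<in>I. \<phi> i a)"
  using assms(2,3)
  by (induction I) (auto intro: constructible_disj constructible_const[OF assms(1)])

lemmas constructible_intros = constructible.neg constructible.conj constructible_disj constructible_imp
  constructible_less constructible_le constructible_eq constructible_ball constructible_bex

section \<open>Polynomials with coefficients in an algebra of functions\<close>

text \<open>The degree may vary with the parameter, but its bound is uniform; evaluation at a member
  of \<open>A\<close> is then one fixed finite sum of products from \<open>A\<close>.\<close>

definition poly_over :: "('a \<Rightarrow> real) set \<Rightarrow> ('a \<Rightarrow> real poly) set" where
  "poly_over A = {Q. (\<forall>i. (\<lambda>a. coeff (Q a) i) \<in> A) \<and> (\<exists>N. \<forall>a. degree (Q a) \<le> N)}"

lemma poly_over_mono: "A \<subseteq> B \<Longrightarrow> poly_over A \<subseteq> poly_over B"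
  unfolding poly_over_def by auto

lemma poly_over_add:
  assumes "fun_algebra A" "P \<in> poly_over A" "Q \<in> poly_over A"
  shows "(\<lambda>a. P a + Q a) \<in> poly_over A"
proof -
  from assms obtain N M where "\<And>a. degree (P a) \<le> N" "\<And>a. degree (Q a) \<le> M"
    unfolding poly_over_def by auto
  then have "degree (P a + Q a) \<le> max N M" for a
    by (meson degree_add_le le_max_iff_disj)
  with assms show ?thesis
    unfolding poly_over_def by (auto intro: fun_algebraD)
qed

lemma poly_over_mult:
  assumes "fun_algebra A" "P \<in> poly_over A" "Q \<in> poly_over A"
  shows "(\<lambda>a. P a * Q a) \<in> poly_over A"
proof -
  from assms obtain N M where "\<And>a. degree (P a) \<le> N" "\<And>a. degree (Q a) \<le> M"
    unfolding poly_over_def by auto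
  then have "degree (P a * Q a) \<le> N + M" for a
    by (meson add_mono degree_mult_le order_trans)
  with assms show ?thesis
    unfolding poly_over_def by (auto simp: coeff_mult intro!: fun_algebra_intros)
qed

lemma poly_over_monom:
  assumes "fun_algebra A" "g \<in> A"
  shows "(\<lambda>a. monom (g a) k) \<in> poly_over A"
proof -
  have "(\<lambda>a. if k = i then g a else 0) \<in> A" for i
    using assms by (cases "k = i") (auto intro: fun_algebraD)
  then show ?thesis
    unfolding poly_over_def using degree_monom_le by auto
qed

lemma poly_over_const:
  assumes "fun_algebra A" "g \<in> A"
  shows "(\<lambda>a. [:g a:]) \<in> poly_over A"
  using poly_over_monom[OF assms, of 0] by (simp add: monom_0)

lemma poly_over_diff:
  assumes "fun_algebra A" "P \<in> poly_over A" "Q \<in> poly_over A"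
  shows "(\<lambda>a. P a - Q a) \<in> poly_over A"
  using poly_over_add[OF assms(1,2) poly_over_mult[OF assms(1) poly_over_const[OF assms(1) fun_algebraD(1)[OF assms(1), of "-1"]] assms(3)]]
  by simp

lemma poly_over_pderiv:
  assumes "fun_algebra A" "P \<in> poly_over A"
  shows "(\<lambda>a. pderiv (P a)) \<in> poly_over A"
proof -
  from assms obtain N where "\<And>a. degree (P a) \<le> N" unfolding poly_over_def by auto
  then have "degree (pderiv (P a)) \<le> N" for a
    by (metis degree_pderiv diff_le_self order_trans)
  with assms show ?thesis
    unfolding poly_over_def by (auto simp: coeff_pderiv intro!: fun_algebra_intros)
qed

lemma poly_over_eval:
  assumes "fun_algebra A" "P \<in> poly_over A" "g \<in> A"
  shows "(\<lambda>a. poly (P a) (g a)) \<in> A"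
proof -
  from assms obtain N where N: "\<And>a. degree (P a) \<le> N" unfolding poly_over_def by auto
  have "(\<lambda>a. \<Sum>i\<le>N. coeff (P a) i * g a ^ i) \<in> A"
    using assms by (auto simp: poly_over_def intro!: fun_algebra_intros)
  then show ?thesis by (simp add: poly_eq_sum_coeff[OF N])
qed

text \<open>Division by a monic polynomial inverts no coefficient, so the remainder stays over
  \<open>A\<close>. Each step of the induction cancels the top coefficient of \<open>Q\<close> for
  all parameters at once.\<close>

lemma poly_over_mod_monic:
  assumes A: "fun_algebra A" and P: "P \<in> poly_over A"
    and deg: "\<And>a. degree (P a) = Suc d" and monic: "\<And>a. coeff (P a) (Suc d) = 1"
    and Q: "Q \<in> poly_over A"
  obtains R where "R \<in> poly_over A" "\<And>a. degree (R a) \<le> d"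
    "\<And>a x. poly (P a) x = 0 \<Longrightarrow> poly (R a) x = poly (Q a) x"
proof -
  have "\<exists>R\<in>poly_over A. (\<forall>a. degree (R a) \<le> d) \<and> (\<forall>a x. poly (P a) x = 0 \<longrightarrow> poly (R a) x = poly (Q a) x)"
    if "\<And>a. degree (Q a) \<le> d + k" "Q \<in> poly_over A" for Q k
    using that
  proof (induction k arbitrary: Q)
    case 0
    then show ?case by auto
  next
    case (Suc k)
    define Q' where "Q' = (\<lambda>a. Q a - monom (coeff (Q a) (d + Suc k)) k * P a)"
    have 1: "Q' \<in> poly_over A"
      unfolding Q'_def
      using Suc.prems(2) by (intro poly_over_diff poly_over_mult poly_over_monom A P) (auto simp: poly_over_def)
    have 2: "degree (Q' a) \<le> d + k" for a
    proof (rule degree_le, intro allI impI)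
      fix i assume i: "d + k < i"
      have dm: "degree (monom (coeff (Q a) (d + Suc k)) k * P a) \<le> d + Suc k"
        by (rule order_trans[OF degree_mult_le]) (use deg[of a] degree_monom_le[of "coeff (Q a) (d + Suc k)" k] in simp)
      show "coeff (Q' a) i = 0"
      proof (cases "i = d + Suc k")
        case True
        then show ?thesis using monic[of a] by (simp add: Q'_def coeff_monom_mult)
      next
        case False
        with i have "i > d + Suc k" by simp
        then show ?thesis using dm Suc.prems(1)[of a] by (simp add: Q'_def coeff_eq_0)
      qed
    qed
    from Suc.IH[OF 2 1] obtain R where R: "R \<in> poly_over A" "\<forall>a. degree (R a) \<le> d"
      "\<forall>a x. poly (P a) x = 0 \<longrightarrow> poly (R a) x = poly (Q' a) x" by blast
    then show ?case by (intro bexI[of _ R]) (auto simp: Q'_def)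
  qed
  moreover from Q obtain N where "\<And>a. degree (Q a) \<le> N"
    unfolding poly_over_def by auto
  then have "degree (Q a) \<le> d + N" for a
    by (simp add: trans_le_add2)
  ultimately show ?thesis using Q that by metis
qed

section \<open>Conservative extensions of algebras\<close>

definition conservative_ext :: "('a \<Rightarrow> real) set \<Rightarrow> ('a \<Rightarrow> real) set \<Rightarrow> bool" where
  "conservative_ext A B \<longleftrightarrow> fun_algebra B \<and> A \<subseteq> B \<and> (\<forall>\<phi>. constructible B \<phi> \<longrightarrow> constructible A \<phi>)"

lemma conservative_ext_refl: "fun_algebra A \<Longrightarrow> conservative_ext A A"
  unfolding conservative_ext_def by auto

lemma conservative_ext_trans:
  "conservative_ext A B \<Longrightarrow> conservative_ext B C \<Longrightarrow> conservative_ext A C"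
  unfolding conservative_ext_def by auto

lemma conservative_extD:
  assumes "conservative_ext A B"
  shows "fun_algebra B" "A \<subseteq> B" "constructible B \<phi> \<Longrightarrow> constructible A \<phi>"
  using assms unfolding conservative_ext_def by auto

text \<open>Adjoining \<open>\<xi>\<close> gives the functions \<open>Q(\<xi>)\<close> with \<open>Q\<close> a polynomial over \<open>A\<close>.\<close>
definition adjoinable :: "('a \<Rightarrow> real) set \<Rightarrow> ('a \<Rightarrow> real) \<Rightarrow> bool" where
  "adjoinable A \<xi> \<longleftrightarrow> (\<forall>Q\<in>poly_over A. constructible A (\<lambda>a. 0 < poly (Q a) (\<xi> a)))"

text \<open>Positivity of a function of the new algebra is just what adjoinability makes
  constructible over \<open>A\<close>; induction over the connectives gives the other
  conditions.\<close>

lemma adjoinable_ext: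
  assumes "fun_algebra A" "adjoinable A \<xi>"
  obtains B where "conservative_ext A B" "\<xi> \<in> B"
proof -
  define B where "B = {(\<lambda>a. poly (Q a) (\<xi> a)) | Q. Q \<in> poly_over A}"
  have in_B: "(\<lambda>a. poly (Q a) (\<xi> a)) \<in> B" if "Q \<in> poly_over A" for Q
    using that unfolding B_def by blast
  have "A \<subseteq> B"
  proof
    fix g assume "g \<in> A"
    from in_B[OF poly_over_const[OF assms(1) this]] show "g \<in> B" by simp
  qed
  moreover have "\<xi> \<in> B"
    using in_B[OF poly_over_monom[OF assms(1) fun_algebraD(1)[OF assms(1), of 1], of 1]]
    by (simp add: poly_monom)
  moreover have "fun_algebra B"
  proof -
    have "(\<lambda>_. c) \<in> B" for c using \<open>A \<subseteq> B\<close> fun_algebraD(1)[OF assms(1)] by auto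
    moreover have "(\<lambda>a. f a + g a) \<in> B \<and> (\<lambda>a. f a * g a) \<in> B" if "f \<in> B" "g \<in> B" for f g
    proof -
      from that obtain P Q where PQ: "P \<in> poly_over A" "Q \<in> poly_over A"
        "f = (\<lambda>a. poly (P a) (\<xi> a))" "g = (\<lambda>a. poly (Q a) (\<xi> a))" unfolding B_def by blast
      from in_B[OF poly_over_add[OF assms(1) PQ(1,2)]] in_B[OF poly_over_mult[OF assms(1) PQ(1,2)]]
      show ?thesis by (simp add: PQ)
    qed
    ultimately show ?thesis unfolding fun_algebra_def by blast
  qed
  moreover have "constructible A \<phi>" if "constructible B \<phi>" for \<phi>
    using that
  proof induction
    case (pos g)
    then show ?case using assms(2) unfolding B_def adjoinable_def by auto
  qed (auto intro: constructible.intros)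
  ultimately show ?thesis using that unfolding conservative_ext_def by blast
qed

text \<open>The functions are adjoined one after another, so each has to be adjoinable over every
  conservative extension that the earlier ones may have produced.\<close>

lemma adjoinable_finite_ext:
  assumes "fun_algebra A" "finite F"
    and "\<And>B \<xi>. conservative_ext A B \<Longrightarrow> \<xi> \<in> F \<Longrightarrow> adjoinable B \<xi>"
  obtains B where "conservative_ext A B" "F \<subseteq> B"
proof -
  have "\<exists>B. conservative_ext A B \<and> F \<subseteq> B"
    using assms(2,3)
  proof (induction F)
    case empty
    then show ?case using conservative_ext_refl[OF assms(1)] by auto
  next
    case (insert \<xi> F)
    then obtain B where B: "conservative_ext A B" "F \<subseteq> B" by auto
    obtain C where C: "conservative_ext B C" "\<xi> \<in> C"
      using adjoinable_ext[OF conservative_extD(1)[OF B(1)] insert.prems[OF B(1)]] by auto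
    then show ?case using B conservative_ext_trans[OF B(1) C(1)] conservative_extD(2)[OF C(1)] by auto
  qed
  then show ?thesis using that by blast
qed

text \<open>Multiplying by the even power \<open>c a ^ (2 * N)\<close> clears the denominators
  without changing the sign where \<open>c a\<close> is nonzero. Where it is zero,
  \<open>inverse 0 = 0\<close> leaves the constant coefficient.\<close>

lemma adjoinable_inverse:
  assumes A: "fun_algebra A" and "c \<in> A"
  shows "adjoinable A (\<lambda>a. inverse (c a))"
  unfolding adjoinable_def
proof
  fix Q assume Q: "Q \<in> poly_over A"
  then obtain N where N: "\<And>a. degree (Q a) \<le> N" unfolding poly_over_def by auto
  let ?h = "\<lambda>a. \<Sum>i\<le>N. coeff (Q a) i * c a ^ (2 * N - i)"
  have eq: "0 < poly (Q a) (inverse (c a)) \<longleftrightarrow>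
      c a = 0 \<and> 0 < coeff (Q a) 0 \<or> c a \<noteq> 0 \<and> 0 < ?h a" for a
  proof (cases "c a = 0")
    case True
    then show ?thesis by (simp add: poly_0_coeff_0)
  next
    case False
    have "?h a = (\<Sum>i\<le>N. c a ^ (2 * N) * (coeff (Q a) i * inverse (c a) ^ i))"
      by (rule sum.cong) (use False in \<open>auto simp: power_diff power_inverse field_simps\<close>)
    also have "\<dots> = c a ^ (2 * N) * poly (Q a) (inverse (c a))"
      by (simp add: poly_eq_sum_coeff[OF N] sum_distrib_left)
    finally show ?thesis using False by (simp add: zero_less_mult_iff power_mult)
  qed
  show "constructible A (\<lambda>a. 0 < poly (Q a) (inverse (c a)))"
    unfolding eq using Q assms
    by (auto simp: poly_over_def intro!: constructible_intros fun_algebra_intros)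
qed

subsection \<open>Adjoining roots\<close>

text \<open>\<open>Z\<close> only has to cover the roots: its members may take other values too.
  Parameters with \<open>P a = 0\<close> are left out because there every real number is a
  root.\<close>

definition roots_in :: "('a \<Rightarrow> real poly) \<Rightarrow> ('a \<Rightarrow> real) set \<Rightarrow> bool" where
  "roots_in P Z \<longleftrightarrow> (\<forall>a x. P a \<noteq> 0 \<longrightarrow> poly (P a) x = 0 \<longrightarrow> (\<exists>z\<in>Z. z a = x))"

lemma roots_inD: "roots_in P Z \<Longrightarrow> P a \<noteq> 0 \<Longrightarrow> poly (P a) x = 0 \<Longrightarrow> \<exists>z\<in>Z. z a = x"
  unfolding roots_in_def by blast

text \<open>The statement for the induction on the degree. It ranges over all algebras because the
  next degree applies it over extensions; the \<open>itself\<close> argument fixes the parameter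
  type.\<close>

definition roots_adjoinable :: "'a itself \<Rightarrow> nat \<Rightarrow> bool" where
  "roots_adjoinable _ d \<longleftrightarrow> (\<forall>(A :: ('a \<Rightarrow> real) set) P. fun_algebra A \<longrightarrow> P \<in> poly_over A \<longrightarrow>
     (\<forall>a. degree (P a) \<le> d) \<longrightarrow> (\<exists>B Z. conservative_ext A B \<and> finite Z \<and> Z \<subseteq> B \<and> roots_in P Z))"

lemma roots_adjoinableE:
  assumes "roots_adjoinable TYPE('a) d" "fun_algebra (A :: ('a \<Rightarrow> real) set)" "P \<in> poly_over A"
    "\<And>a. degree (P a) \<le> d"
  obtains B Z where "conservative_ext A B" "finite Z" "Z \<subseteq> B" "roots_in P Z"
  using assms unfolding roots_adjoinable_def by metis

text \<open>In use, \<open>H\<close> covers the roots of the derivative. \<open>P a\<close> is then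
  strictly monotone between the bounds, and the opposite signs at the ends give exactly one
  root.\<close>

definition isolating :: "('a \<Rightarrow> real poly) \<Rightarrow> ('a \<Rightarrow> real) set \<Rightarrow> ('a \<Rightarrow> real) \<Rightarrow> ('a \<Rightarrow> real) \<Rightarrow> 'a \<Rightarrow> bool" where
  "isolating P H l u a \<longleftrightarrow> l a < u a \<and> (\<forall>h\<in>H. \<not> (l a < h a \<and> h a < u a)) \<and>
     poly (P a) (l a) * poly (P a) (u a) < 0"

definition isolated_root :: "('a \<Rightarrow> real poly) \<Rightarrow> ('a \<Rightarrow> real) set \<Rightarrow> ('a \<Rightarrow> real) \<Rightarrow> ('a \<Rightarrow> real) \<Rightarrow> 'a \<Rightarrow> real" where
  "isolated_root P H l u a =
     (if isolating P H l u a then SOME x. l a < x \<and> x < u a \<and> poly (P a) x = 0 else 0)"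

lemma isolated_root:
  assumes "isolating P H l u a"
  shows "l a < isolated_root P H l u a" "isolated_root P H l u a < u a"
    "poly (P a) (isolated_root P H l u a) = 0"
proof -
  have "\<exists>x. l a < x \<and> x < u a \<and> poly (P a) x = 0"
  proof (cases "poly (P a) (l a) < 0")
    case True
    with assms have "poly (P a) (u a) > 0" "l a < u a"
      unfolding isolating_def by (auto simp: mult_less_0_iff)
    then show ?thesis using True poly_IVT_pos by blast
  next
    case False
    with assms have "poly (P a) (l a) > 0" "poly (P a) (u a) < 0" "l a < u a"
      unfolding isolating_def by (auto simp: mult_less_0_iff)
    then show ?thesis using poly_IVT_neg by blast
  qed
  from someI_ex[OF this] assms
  show "l a < isolated_root P H l u a" "isolated_root P H l u a < u a"
    "poly (P a) (isolated_root P H l u a) = 0"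
    by (simp_all add: isolated_root_def)
qed

text \<open>The neighbours of \<open>x\<close> in \<open>E\<close> are taken strictly on either
  side; \<open>x\<close> may itself belong to \<open>E\<close>, which is why \<open>e = x\<close> is
  allowed.\<close>

lemma nearest_below_above:
  fixes E :: "real set"
  assumes "finite E" "l \<in> E" "u \<in> E" "l < x" "x < u"
  obtains l' u' where "l' \<in> E" "u' \<in> E" "l \<le> l'" "u' \<le> u" "l' < x" "x < u'"
    "\<forall>e\<in>E. l' < e \<and> e < u' \<longrightarrow> e = x"
proof -
  let ?L = "{e\<in>E. e < x}" and ?U = "{e\<in>E. x < e}"
  have f: "finite ?L" "finite ?U" "l \<in> ?L" "u \<in> ?U" using assms by auto
  then have "Max ?L \<in> ?L" "Min ?U \<in> ?U" using Max_in[of ?L] Min_in[of ?U] by blast+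
  moreover have "l \<le> Max ?L" "Min ?U \<le> u" using f by auto
  moreover have "e = x" if "e \<in> E" "Max ?L < e" "e < Min ?U" for e
  proof (rule ccontr)
    assume "e \<noteq> x"
    then have "e \<in> ?L \<or> e \<in> ?U" using that by auto
    then show False using Max_ge[OF f(1), of e] Min_le[OF f(2), of e] that by auto
  qed
  ultimately show ?thesis using that[of "Max ?L" "Min ?U"] by auto
qed

text \<open>
  The sign of \<open>Q\<close> at the isolated root \<open>\<xi>\<close> of the monic polynomial \<open>P\<close> is that of its remainder \<open>R\<close>
  modulo \<open>P\<close>.  Unless it vanishes, it is the sign of \<open>R\<close> at the midpoint of two bounds on \<open>\<xi>\<close> that enclose
  no root of \<open>R\<close>; and the position of \<open>\<xi>\<close> relative to a bound \<open>z\<close> is read off the sign of \<open>P\<close> at \<open>z\<close>.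
\<close>
lemma adjoinable_isolated_root:
  fixes A :: "('a \<Rightarrow> real) set"
  assumes IH: "roots_adjoinable TYPE('a) d" and A: "fun_algebra A" and P: "P \<in> poly_over A"
    and deg: "\<And>a. degree (P a) = Suc d" and monic: "\<And>a. coeff (P a) (Suc d) = 1"
    and H: "finite H" "H \<subseteq> A" "roots_in (\<lambda>a. pderiv (P a)) H" and lu: "l \<in> A" "u \<in> A"
  shows "adjoinable A (isolated_root P H l u)"
  unfolding adjoinable_def
proof
  fix Q assume Q: "Q \<in> poly_over A"
  define \<xi> where "\<xi> = isolated_root P H l u"
  obtain R where R: "R \<in> poly_over A" "\<And>a. degree (R a) \<le> d"
    "\<And>a x. poly (P a) x = 0 \<Longrightarrow> poly (R a) x = poly (Q a) x"
    using poly_over_mod_monic[OF A P deg monic Q] by blast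
  obtain B Z where B: "conservative_ext A B" and Z: "finite Z" "Z \<subseteq> B" "roots_in R Z"
    using roots_adjoinableE[OF IH A R(1,2)] by blast
  note B' = conservative_extD[OF B]
  define below where "below z a \<longleftrightarrow> z a \<le> l a \<or> (z a < u a \<and> 0 < poly (P a) (z a) * poly (P a) (l a))" for z a
  define above where "above z a \<longleftrightarrow> u a \<le> z a \<or> (l a < z a \<and> 0 < poly (P a) (z a) * poly (P a) (u a))" for z a
  \<comment> \<open>With \<open>l\<close> and \<open>u\<close> in \<open>E\<close>, the root has
    neighbours on both sides.\<close>
  define E where "E = insert l (insert u Z)"
  \<comment> \<open>Members of \<open>Z\<close> between the bounds may fail to be roots of
    \<open>R a\<close>, so \<open>R a\<close> is tested at them.\<close>
  define \<Phi> where "\<Phi> a \<longleftrightarrow> (\<exists>l'\<in>E. \<exists>u'\<in>E. below l' a \<and> above u' a \<and>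
      (\<forall>z\<in>Z. l' a < z a \<and> z a < u' a \<longrightarrow> poly (R a) (z a) \<noteq> 0) \<and>
      0 < poly (R a) ((l' a + u' a) * (1/2)))" for a
  have E: "finite E" "E \<subseteq> B" using Z B'(2) lu unfolding E_def by auto
  have eq: "0 < poly (Q a) (\<xi> a) \<longleftrightarrow>
    (\<not> isolating P H l u a \<and> 0 < poly (Q a) 0) \<or> (isolating P H l u a \<and> \<Phi> a)" for a
  proof (cases "isolating P H l u a")
    case False
    then show ?thesis by (simp add: \<xi>_def isolated_root_def)
  next
    case True
    note \<xi> = isolated_root[OF True, folded \<xi>_def]
    have "pderiv (P a) \<noteq> 0"
      using deg[of a] by (auto simp: pderiv_eq_0_iff)
    then have nz: "poly (pderiv (P a)) z \<noteq> 0" if "l a < z" "z < u a" for z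
      using roots_inD[OF H(3), of a z] True that unfolding isolating_def by auto
    have below: "below z a \<longleftrightarrow> z a < \<xi> a" for z
    proof (cases "l a < z a \<and> z a < u a")
      case True
      then show ?thesis
        using poly_sign_change_iff(2)[OF nz \<xi>, of "z a"] by (auto simp: below_def)
    qed (use \<xi> in \<open>auto simp: below_def\<close>)
    have above: "above z a \<longleftrightarrow> \<xi> a < z a" for z
    proof (cases "l a < z a \<and> z a < u a")
      case True
      then show ?thesis
        using poly_sign_change_iff(3)[OF nz \<xi>, of "z a"] by (auto simp: above_def)
    qed (use \<xi> in \<open>auto simp: above_def\<close>)
    have "0 < poly (R a) (\<xi> a) \<longleftrightarrow> \<Phi> a"
    proof
      assume pos: "0 < poly (R a) (\<xi> a)"
      then have R0: "R a \<noteq> 0" by auto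
      obtain l' u' where l'u': "l' \<in> (\<lambda>e. e a) ` E" "u' \<in> (\<lambda>e. e a) ` E" "l' < \<xi> a" "\<xi> a < u'"
        "\<forall>e\<in>(\<lambda>e. e a) ` E. l' < e \<and> e < u' \<longrightarrow> e = \<xi> a"
      proof (rule nearest_below_above[of "(\<lambda>e. e a) ` E" "l a" "u a" "\<xi> a"])
      qed (use E(1) \<xi> in \<open>auto simp: E_def\<close>)
      then obtain l2 u2 where l2: "l2 \<in> E" "l' = l2 a" and u2: "u2 \<in> E" "u' = u2 a" by auto
      \<comment> \<open>The only value from \<open>Z\<close> that can occur strictly between the two
        neighbours is \<open>\<xi> a\<close>, and \<open>R a\<close> is positive there.\<close>
      have nzR: "poly (R a) z \<noteq> 0" if "l' < z" "z < u'" for z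
        using roots_inD[OF Z(3) R0, of z] l'u'(5) that pos unfolding E_def by fastforce
      have "0 < poly (R a) ((l2 a + u2 a) * (1/2))"
        by (rule poly_pos_interval[OF nzR _ _ _ _ pos]) (use l2 u2 l'u'(3,4) in auto)
      then show "\<Phi> a"
        unfolding \<Phi>_def below above using l2 u2 l'u'(3,4) nzR by auto
    next
      assume "\<Phi> a"
      then obtain l' u' where *: "l' a < \<xi> a" "\<xi> a < u' a"
        "\<forall>z\<in>Z. l' a < z a \<and> z a < u' a \<longrightarrow> poly (R a) (z a) \<noteq> 0"
        "0 < poly (R a) ((l' a + u' a) * (1/2))"
        unfolding \<Phi>_def below above by blast
      then have R0: "R a \<noteq> 0" by auto
      have nzR: "poly (R a) z \<noteq> 0" if "l' a < z" "z < u' a" for z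
        using roots_inD[OF Z(3) R0, of z] *(3) that by auto
      show "0 < poly (R a) (\<xi> a)"
        by (rule poly_pos_interval[OF nzR _ _ _ _ *(4)]) (use *(1,2) in auto)
    qed
    then show ?thesis using True R(3)[OF \<xi>(3)] by simp
  qed
  have PB: "P \<in> poly_over B" "Q \<in> poly_over B" "R \<in> poly_over B"
    using P Q R(1) poly_over_mono[OF B'(2)] by auto
  have mem: "l \<in> B" "u \<in> B" "\<And>z. z \<in> Z \<Longrightarrow> z \<in> B" "\<And>h. h \<in> H \<Longrightarrow> h \<in> B" "\<And>z. z \<in> E \<Longrightarrow> z \<in> B"
    using lu Z H E B'(2) by auto
  note evP = poly_over_eval[OF B'(1) PB(1)] and evR = poly_over_eval[OF B'(1) PB(3)]
  have iso: "constructible B (isolating P H l u)"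
    unfolding isolating_def[abs_def]
    by (intro constructible_intros fun_algebraD B'(1) H(1) evP mem)
  have bel: "constructible B (below z)" "constructible B (above z)" if "z \<in> B" for z
    unfolding below_def[abs_def] above_def[abs_def]
    by (intro constructible_intros fun_algebraD B'(1) H(1) evP mem that)+
  have free: "constructible B (\<lambda>a. \<forall>z\<in>Z. l' a < z a \<and> z a < u' a \<longrightarrow> poly (R a) (z a) \<noteq> 0)"
    if "l' \<in> B" "u' \<in> B" for l' u'
    by (intro constructible_intros fun_algebraD(1) B'(1) Z(1) evR that) (use Z(2) in auto)
  have mid: "constructible B (\<lambda>a. 0 < poly (R a) ((l' a + u' a) * (1/2)))"
    if "l' \<in> B" "u' \<in> B" for l' u'
    by (intro constructible.pos evR fun_algebraD B'(1) that)
  have Phi: "constructible B \<Phi>"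
    unfolding \<Phi>_def[abs_def]
    by (intro constructible_bex constructible.conj B'(1) E(1) bel free mid mem(5))
  have "constructible B (\<lambda>a. 0 < poly (Q a) (\<xi> a))"
    unfolding eq
    by (intro constructible_intros iso Phi B'(1) fun_algebraD poly_over_eval[OF B'(1) PB(2)])
  then show "constructible A (\<lambda>a. 0 < poly (Q a) (isolated_root P H l u a))"
    unfolding \<xi>_def by (rule B'(3))
qed

text \<open>A root is either a root of the derivative, found in \<open>H\<close>, or lies between
  two neighbours in \<open>E\<close> that enclose no critical point and so isolate it. The right
  pair depends on the parameter; adjoining the isolated roots for all pairs from \<open>E\<close>
  covers every case.\<close>

lemma roots_adjoinable_monic:
  fixes A :: "('a \<Rightarrow> real) set"
  assumes IH: "roots_adjoinable TYPE('a) d" and A: "fun_algebra A" and P: "P \<in> poly_over A"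
    and deg: "\<And>a. degree (P a) = Suc d" and monic: "\<And>a. coeff (P a) (Suc d) = 1"
  obtains B Z where "conservative_ext A B" "finite Z" "Z \<subseteq> B" "roots_in P Z"
proof -
  have "degree (pderiv (P a)) \<le> d" for a using deg[of a] by (simp add: degree_pderiv)
  then obtain B H where B: "conservative_ext A B" and H: "finite H" "H \<subseteq> B" "roots_in (\<lambda>a. pderiv (P a)) H"
    using roots_adjoinableE[OF IH A poly_over_pderiv[OF A P]] by blast
  note B' = conservative_extD[OF B]
  define M where "M = (\<lambda>a. 2 + (\<Sum>i\<le>d. (coeff (P a) i)\<^sup>2 + 1))"
  have "M \<in> B" unfolding M_def
    using P B'(2) by (intro fun_algebra_intros B'(1)) (auto simp: poly_over_def)
  then have M: "M \<in> B" "(\<lambda>a. - M a) \<in> B" using fun_algebra_uminus[OF B'(1)] by auto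
  \<comment> \<open>\<open>M\<close> and its negative enclose all roots, so a root has neighbours
    even if the derivative has no root.\<close>
  define E where "E = insert M (insert (\<lambda>a. - M a) H)"
  have E: "finite E" "E \<subseteq> B" using H M unfolding E_def by auto
  define F where "F = (\<lambda>(l, u). isolated_root P H l u) ` (E \<times> E)"
  have adj: "adjoinable C \<xi>" if C: "conservative_ext B C" and "\<xi> \<in> F" for C \<xi>
  proof -
    from \<open>\<xi> \<in> F\<close> obtain l u where lu: "\<xi> = isolated_root P H l u" "l \<in> E" "u \<in> E" unfolding F_def by auto
    note C' = conservative_extD[OF C]
    show ?thesis unfolding lu(1)
      using P poly_over_mono[OF order_trans[OF B'(2) C'(2)]] H E lu C'(2)
      by (intro adjoinable_isolated_root[OF IH C'(1) _ deg monic]) auto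
  qed
  obtain C where C: "conservative_ext B C" "F \<subseteq> C"
    using adjoinable_finite_ext[OF B'(1) _ adj, of F] E(1) unfolding F_def by blast
  show ?thesis
  proof
    show "conservative_ext A C" by (rule conservative_ext_trans[OF B C(1)])
    show "finite (F \<union> H)" "F \<union> H \<subseteq> C"
      using C H E(1) conservative_extD(2)[OF C(1)] unfolding F_def by auto
    have "\<exists>z\<in>F \<union> H. z a = x" if root: "poly (P a) x = 0" for a x
    proof (cases "\<exists>h\<in>H. h a = x")
      case False
      have xM: "\<bar>x\<bar> < M a" unfolding M_def by (rule monic_root_bound[OF deg monic root])
      obtain l' u' where l'u': "l' \<in> (\<lambda>e. e a) ` E" "u' \<in> (\<lambda>e. e a) ` E" "l' < x" "x < u'"
        "\<forall>e\<in>(\<lambda>e. e a) ` E. l' < e \<and> e < u' \<longrightarrow> e = x"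
      proof (rule nearest_below_above[of "(\<lambda>e. e a) ` E" "- M a" "M a" x])
        show "- M a \<in> (\<lambda>e. e a) ` E"
          unfolding E_def by (rule image_eqI[of _ _ "\<lambda>a. - M a"]) auto
      qed (use E(1) xM in \<open>auto simp: E_def\<close>)
      then obtain l u where l: "l \<in> E" "l' = l a" and u: "u \<in> E" "u' = u a" by auto
      have noH: "\<not> (l a < h a \<and> h a < u a)" if "h \<in> H" for h
        using l'u'(5) False that l(2) u(2) unfolding E_def by auto
      have "pderiv (P a) \<noteq> 0" using deg[of a] by (auto simp: pderiv_eq_0_iff)
      then have nz: "poly (pderiv (P a)) z \<noteq> 0" if "l a < z" "z < u a" for z
        using roots_inD[OF H(3), of a z] noH that by auto
      note lxu = l'u'(3,4)[unfolded l u]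
      have iso: "isolating P H l u a"
        unfolding isolating_def using noH lxu poly_sign_change_iff(1)[OF nz lxu root] by auto
      note \<xi> = isolated_root[OF iso]
      \<comment> \<open>A root on either side of \<open>x\<close> would, by the sign criterion, be a
        point where \<open>P a\<close> is nonzero.\<close>
      have "\<not> isolated_root P H l u a < x" "\<not> x < isolated_root P H l u a"
        using poly_sign_change_iff(2,3)[OF nz lxu root \<xi>(1,2)] \<xi>(3) by auto
      then have "isolated_root P H l u a = x" by linarith
      moreover have "isolated_root P H l u \<in> F" unfolding F_def using l u by auto
      ultimately show ?thesis by blast
    qed blast
    then show "roots_in P (F \<union> H)" unfolding roots_in_def by blast
  qed
qed

text \<open>The leading coefficient may vanish at some parameters. There \<open>P\<close> coincides
  with its truncation \<open>P0\<close>; elsewhere it has the same roots as the monic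
  \<open>P1\<close>. The two families of roots are adjoined in turn.\<close>

lemma roots_adjoinable: "roots_adjoinable TYPE('a) d"
proof (induction d)
  case 0
  have "roots_in P {}" if deg: "\<And>a. degree (P a) = 0" for P :: "'a \<Rightarrow> real poly"
    unfolding roots_in_def
  proof (intro allI impI)
    fix a x assume "P a \<noteq> 0" "poly (P a) x = 0"
    moreover obtain c where "P a = [:c:]" using degree_eq_zeroE[OF deg[of a]] by blast
    ultimately show "\<exists>z\<in>{}. z a = x" by auto
  qed
  then show ?case
    unfolding roots_adjoinable_def using conservative_ext_refl by (metis empty_subsetI finite.emptyI le_zero_eq)
next
  case (Suc d)
  show ?case unfolding roots_adjoinable_def
  proof (intro allI impI)
    fix A :: "('a \<Rightarrow> real) set" and P assume A: "fun_algebra A" and P: "P \<in> poly_over A"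
      and deg: "\<forall>a. degree (P a) \<le> Suc d"
    define c where "c = (\<lambda>a. coeff (P a) (Suc d))"
    have "c \<in> A" using P unfolding c_def poly_over_def by auto
    obtain B where B: "conservative_ext A B" "(\<lambda>a. inverse (c a)) \<in> B"
      using adjoinable_ext[OF A adjoinable_inverse[OF A \<open>c \<in> A\<close>]] by blast
    note B' = conservative_extD[OF B(1)]
    have PB: "P \<in> poly_over B" "c \<in> B" using P \<open>c \<in> A\<close> poly_over_mono[OF B'(2)] B'(2) by auto
    define P0 where "P0 = (\<lambda>a. P a - monom (c a) (Suc d))"
    have P0: "P0 \<in> poly_over B"
      unfolding P0_def by (intro poly_over_diff poly_over_monom B'(1) PB)
    have P0deg: "degree (P0 a) \<le> d" for a
    proof (rule degree_le, intro allI impI)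
      fix i assume "d < i"
      then show "coeff (P0 a) i = 0"
        using deg[rule_format, of a] by (cases "i = Suc d") (auto simp: P0_def c_def coeff_eq_0)
    qed
    \<comment> \<open>Where \<open>c a\<close> is zero, \<open>inverse 0 = 0\<close> leaves the pure
      power of degree \<open>Suc d\<close>, so \<open>P1\<close> is monic of the same degree for
      every parameter.\<close>
    define P1 where "P1 = (\<lambda>a. [:inverse (c a):] * P0 a + monom 1 (Suc d))"
    have P1: "P1 \<in> poly_over B"
      unfolding P1_def
      by (intro poly_over_add poly_over_mult poly_over_const poly_over_monom fun_algebraD(1) B'(1) B(2) P0)
    have "coeff (P0 a) (Suc d) = 0" for a by (simp add: P0_def c_def)
    then have monic: "coeff (P1 a) (Suc d) = 1" for a by (simp add: P1_def)
    have P1deg: "degree (P1 a) = Suc d" for a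
    proof (rule antisym)
      show "degree (P1 a) \<le> Suc d"
        unfolding P1_def using P0deg[of a]
        by (intro degree_add_le degree_monom_le) (simp add: le_SucI)
      show "Suc d \<le> degree (P1 a)" using monic[of a] by (intro le_degree) simp
    qed
    obtain C Z0 where C: "conservative_ext B C" and Z0: "finite Z0" "Z0 \<subseteq> C" "roots_in P0 Z0"
      using roots_adjoinableE[OF Suc.IH B'(1) P0 P0deg] by blast
    note C' = conservative_extD[OF C]
    have P1C: "P1 \<in> poly_over C" using P1 poly_over_mono[OF C'(2)] by auto
    obtain D Z1 where D: "conservative_ext C D" and Z1: "finite Z1" "Z1 \<subseteq> D" "roots_in P1 Z1"
      using roots_adjoinable_monic[OF Suc.IH C'(1) P1C P1deg monic] by blast
    have "roots_in P (Z0 \<union> Z1)"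
      unfolding roots_in_def
    proof (intro allI impI)
      fix a x assume ax: "P a \<noteq> 0" "poly (P a) x = 0"
      show "\<exists>z\<in>Z0 \<union> Z1. z a = x"
      proof (cases "c a = 0")
        case True
        then have "P0 a = P a" by (simp add: P0_def)
        then show ?thesis using roots_inD[OF Z0(3), of a x] ax by auto
      next
        case False
        have "P1 a = smult (inverse (c a)) (P a)"
          using False by (simp add: P1_def P0_def smult_diff_right smult_monom)
        then show ?thesis using roots_inD[OF Z1(3), of a x] ax False by auto
      qed
    qed
    then show "\<exists>B Z. conservative_ext A B \<and> finite Z \<and> Z \<subseteq> B \<and> roots_in P Z"
      using Z0 Z1 conservative_extD(2)[OF D] conservative_ext_trans[OF B(1) conservative_ext_trans[OF C D]]
      by (intro exI[of _ D] exI[of _ "Z0 \<union> Z1"]) auto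
  qed
qed

lemma roots_adjoinable_finite:
  fixes A :: "('a \<Rightarrow> real) set"
  assumes "fun_algebra A" "finite F" "F \<subseteq> poly_over A"
  obtains B Z where "conservative_ext A B" "finite Z" "Z \<subseteq> B" "\<And>P. P \<in> F \<Longrightarrow> roots_in P Z"
proof -
  have "\<exists>B Z. conservative_ext A B \<and> finite Z \<and> Z \<subseteq> B \<and> (\<forall>P\<in>F. roots_in P Z)"
    using assms(2,3)
  proof (induction F)
    case empty
    then show ?case using conservative_ext_refl[OF assms(1)] by auto
  next
    case (insert P F)
    then obtain B Z where B: "conservative_ext A B" "finite Z" "Z \<subseteq> B" "\<forall>P\<in>F. roots_in P Z" by auto
    note B' = conservative_extD[OF B(1)]
    have P: "P \<in> poly_over B" using insert.prems poly_over_mono[OF B'(2)] by auto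
    then obtain N where N: "\<And>a. degree (P a) \<le> N" unfolding poly_over_def by auto
    obtain C Y where C: "conservative_ext B C" "finite Y" "Y \<subseteq> C" "roots_in P Y"
      using roots_adjoinableE[OF roots_adjoinable B'(1) P N] by blast
    have "\<forall>P\<in>insert P F. roots_in P (Z \<union> Y)" using B(4) C(4) unfolding roots_in_def by blast
    moreover have "Z \<union> Y \<subseteq> C" using B(3) C(3) conservative_extD(2)[OF C(1)] by blast
    ultimately show ?case
      using conservative_ext_trans[OF B(1) C(1)] B(2) C(2) by blast
  qed
  then show ?thesis using that by blast
qed

subsection \<open>Quantifier elimination\<close>

text \<open>On a gap between neighbouring points of \<open>Z\<close>, or beyond all of them, each
  polynomial of the family has constant sign. A point of \<open>Z\<close> tests itself, a midpoint
  tests a bounded gap, and a shift by 1 an unbounded one.\<close>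

lemma sign_equivalent_test_point:
  fixes Z :: "real set" and \<P> :: "real poly set"
  assumes Z: "finite Z" "Z \<noteq> {}"
    and roots: "\<And>p z. p \<in> \<P> \<Longrightarrow> p \<noteq> 0 \<Longrightarrow> poly p z = 0 \<Longrightarrow> z \<in> Z"
  obtains z w y where "z \<in> Z" "w \<in> Z" "y \<in> {z, z + 1, z - 1, (z + w) * (1/2)}"
    "\<forall>p\<in>\<P>. 0 < poly p x \<longleftrightarrow> 0 < poly p y"
proof (cases "x \<in> Z")
  case True
  then show ?thesis using that[of x x x] by auto
next
  case False
  have same: "\<forall>p\<in>\<P>. 0 < poly p x \<longleftrightarrow> 0 < poly p y"
    if "l < x" "x < u" "l < y" "y < u" "\<And>z. z \<in> Z \<Longrightarrow> \<not> (l < z \<and> z < u)" for l u y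
  proof
    fix p assume "p \<in> \<P>"
    have "poly p z \<noteq> 0" if "p \<noteq> 0" "l < z" "z < u" for z
      using that roots[OF \<open>p \<in> \<P>\<close>] \<open>\<And>z. z \<in> Z \<Longrightarrow> \<not> (l < z \<and> z < u)\<close> by blast
    then show "0 < poly p x \<longleftrightarrow> 0 < poly p y"
      using poly_pos_interval[of l u p x y] poly_pos_interval[of l u p y x] that(1-4)
      by (cases "p = 0") auto
  qed
  let ?lo = "Min Z" and ?hi = "Max Z"
  have lohi: "?lo \<in> Z" "?hi \<in> Z" "\<And>z. z \<in> Z \<Longrightarrow> ?lo \<le> z \<and> z \<le> ?hi" using Z by auto
  consider "x < ?lo" | "?hi < x" | "?lo < x" "x < ?hi"
    using False lohi by (metis linorder_neqE_linordered_idom)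
  then show ?thesis
  proof cases
    case 1
    \<comment> \<open>\<open>same\<close> works on bounded intervals; any number below both
      \<open>x\<close> and \<open>?lo - 1\<close> serves as the left end.\<close>
    have "\<forall>p\<in>\<P>. 0 < poly p x \<longleftrightarrow> 0 < poly p (?lo - 1)"
      by (rule same[of "min x (?lo - 1) - 1" ?lo]) (use 1 lohi in force)+
    then show ?thesis using that[of ?lo ?lo "?lo - 1"] lohi by auto
  next
    case 2
    have "\<forall>p\<in>\<P>. 0 < poly p x \<longleftrightarrow> 0 < poly p (?hi + 1)"
      by (rule same[of ?hi "max x (?hi + 1) + 1"]) (use 2 lohi in force)+
    then show ?thesis using that[of ?hi ?hi "?hi + 1"] lohi by auto
  next
    case 3
    obtain l u where lu: "l \<in> Z" "u \<in> Z" "l < x" "x < u" "\<forall>e\<in>Z. l < e \<and> e < u \<longrightarrow> e = x"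
      by (rule nearest_below_above[OF Z(1) lohi(1,2) 3]) blast
    have "\<forall>p\<in>\<P>. 0 < poly p x \<longleftrightarrow> 0 < poly p ((l + u) * (1/2))"
      by (rule same[of l u]) (use lu False in auto)
    then show ?thesis using that[of l u "(l + u) * (1/2)"] lu by auto
  qed
qed

section \<open>Elimination of variables from polynomial conditions\<close>

inductive_set polynomials :: "(('i \<Rightarrow> real) \<Rightarrow> real) set" where
  const: "(\<lambda>_. c) \<in> polynomials"
| var: "(\<lambda>v. v i) \<in> polynomials"
| add: "f \<in> polynomials \<Longrightarrow> g \<in> polynomials \<Longrightarrow> (\<lambda>v. f v + g v) \<in> polynomials"
| mult: "f \<in> polynomials \<Longrightarrow> g \<in> polynomials \<Longrightarrow> (\<lambda>v. f v * g v) \<in> polynomials"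

lemma fun_algebra_polynomials: "fun_algebra polynomials"
  unfolding fun_algebra_def by (auto intro: polynomials.intros)

text \<open>Singles out the variable \<open>i\<close>, so that the results on roots apply with the
  assignment \<open>v\<close> as parameter.\<close>

lemma polynomials_fun_upd:
  assumes "g \<in> polynomials"
  obtains P where "P \<in> poly_over polynomials" "\<And>v x. g (v(i := x)) = poly (P v) x"
proof -
  note A = fun_algebra_polynomials
  have "\<exists>P\<in>poly_over polynomials. \<forall>v x. g (v(i := x)) = poly (P v) x"
    using assms
  proof induction
    case (const c)
    show ?case
      by (rule bexI[OF _ poly_over_const[OF A polynomials.const[of c]]]) simp
  next
    case (var j)
    show ?case
    proof (cases "i = j")
      case True
      then show ?thesis
        by (intro bexI[OF _ poly_over_monom[OF A polynomials.const[of 1], of 1]]) (simp add: poly_monom)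
    next
      case False
      then show ?thesis
        by (intro bexI[OF _ poly_over_const[OF A polynomials.var[of j]]]) simp
    qed
  next
    case (add f g)
    then obtain P Q where "P \<in> poly_over polynomials" "Q \<in> poly_over polynomials"
      "\<forall>v x. f (v(i := x)) = poly (P v) x" "\<forall>v x. g (v(i := x)) = poly (Q v) x" by blast
    then show ?case by (intro bexI[OF _ poly_over_add[OF A, of P Q]]) (simp_all del: fun_upd_apply)
  next
    case (mult f g)
    then obtain P Q where "P \<in> poly_over polynomials" "Q \<in> poly_over polynomials"
      "\<forall>v x. f (v(i := x)) = poly (P v) x" "\<forall>v x. g (v(i := x)) = poly (Q v) x" by blast
    then show ?case by (intro bexI[OF _ poly_over_mult[OF A, of P Q]]) (simp_all del: fun_upd_apply)
  qed
  then show ?thesis using that by blast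
qed

lemma constructible_fun_upd:
  assumes "constructible polynomials \<phi>" "fun_algebra B" "polynomials \<subseteq> B" "\<tau> \<in> B"
  shows "constructible B (\<lambda>v. \<phi> (v(i := \<tau> v)))"
  using assms(1)
proof induction
  case (pos g)
  obtain P where P: "P \<in> poly_over polynomials" "\<And>v x. g (v(i := x)) = poly (P v) x"
    using polynomials_fun_upd[OF pos] by blast
  show ?case unfolding P(2)
    using P(1) poly_over_mono[OF assms(3)] by (intro constructible.pos poly_over_eval assms(2,4)) auto
qed (rule constructible.intros; assumption)+

text \<open>\<open>F\<close> collects the one-variable polynomials that come from the atoms; the
  connectives only see their signs.\<close>

lemma constructible_depends_on_signs:
  assumes "constructible polynomials \<phi>"
  obtains F where "finite F" "F \<subseteq> poly_over polynomials"
    "\<And>v x y. \<forall>P\<in>F. 0 < poly (P v) x \<longleftrightarrow> 0 < poly (P v) y \<Longrightarrow> \<phi> (v(i := x)) \<longleftrightarrow> \<phi> (v(i := y))"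
proof -
  have "\<exists>F. finite F \<and> F \<subseteq> poly_over polynomials \<and>
    (\<forall>v x y. (\<forall>P\<in>F. 0 < poly (P v) x \<longleftrightarrow> 0 < poly (P v) y) \<longrightarrow> (\<phi> (v(i := x)) \<longleftrightarrow> \<phi> (v(i := y))))"
    using assms
  proof induction
    case (pos g)
    obtain P where P: "P \<in> poly_over polynomials" "\<And>v x. g (v(i := x)) = poly (P v) x"
      using polynomials_fun_upd[OF pos] by blast
    show ?case by (rule exI[of _ "{P}"]) (use P in \<open>auto simp del: fun_upd_apply\<close>)
  next
    case (conj \<phi> \<psi>)
    then obtain F G where
      F: "finite F" "F \<subseteq> poly_over polynomials" 
        "\<forall>v x y. (\<forall>P\<in>F. 0 < poly (P v) x \<longleftrightarrow> 0 < poly (P v) y) \<longrightarrow> (\<phi> (v(i := x)) \<longleftrightarrow> \<phi> (v(i := y)))" and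
      G: "finite G" "G \<subseteq> poly_over polynomials" 
        "\<forall>v x y. (\<forall>P\<in>G. 0 < poly (P v) x \<longleftrightarrow> 0 < poly (P v) y) \<longrightarrow> (\<psi> (v(i := x)) \<longleftrightarrow> \<psi> (v(i := y)))"
      by blast
    have "(\<phi> (v(i := x)) \<and> \<psi> (v(i := x))) = (\<phi> (v(i := y)) \<and> \<psi> (v(i := y)))"
      if "\<forall>P\<in>F \<union> G. 0 < poly (P v) x \<longleftrightarrow> 0 < poly (P v) y" for v x y
      using F(3)[rule_format, of v x y] G(3)[rule_format, of v x y] that by blast
    then show ?case using F(1,2) G(1,2)
      by (intro exI[of _ "F \<union> G"] conjI allI impI finite_UnI Un_least)
  qed auto
  then show ?thesis using that by blast
qed

theorem constructible_ex_fun_upd: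
  assumes \<phi>: "constructible polynomials \<phi>"
  shows "constructible polynomials (\<lambda>v. \<exists>x. \<phi> (v(i := x)))"
proof -
  obtain F where F: "finite F" "F \<subseteq> poly_over polynomials"
    "\<And>v x y. \<forall>P\<in>F. 0 < poly (P v) x \<longleftrightarrow> 0 < poly (P v) y \<Longrightarrow> \<phi> (v(i := x)) \<longleftrightarrow> \<phi> (v(i := y))"
    using constructible_depends_on_signs[OF \<phi>, of i] by blast
  obtain B Z where B: "conservative_ext polynomials B" and Z: "finite Z" "Z \<subseteq> B" "\<And>P. P \<in> F \<Longrightarrow> roots_in P Z"
    using roots_adjoinable_finite[OF fun_algebra_polynomials F(1,2)] by blast
  note B' = conservative_extD[OF B]
  \<comment> \<open>The zero function keeps the set of candidates nonempty even when
    \<open>Z\<close> is empty.\<close>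
  define Z0 where "Z0 = insert (\<lambda>_. 0) Z"
  have Z0: "finite Z0" "Z0 \<subseteq> B" using Z fun_algebraD(1)[OF B'(1)] unfolding Z0_def by auto
  define T where "T = (\<Union>z\<in>Z0. \<Union>w\<in>Z0. {z, \<lambda>v. z v + 1, \<lambda>v. z v - 1, \<lambda>v. (z v + w v) * (1/2)})"
  have T: "finite T" "T \<subseteq> B"
  proof -
    show "finite T" using Z0(1) unfolding T_def by simp
    have "{z, \<lambda>v. z v + 1, \<lambda>v. z v - 1, \<lambda>v. (z v + w v) * (1/2)} \<subseteq> B" if "z \<in> B" "w \<in> B" for z w
      unfolding insert_subset by (intro conjI fun_algebraD fun_algebra_diff B'(1) that empty_subsetI)
    then show "T \<subseteq> B" using Z0(2) unfolding T_def by blast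
  qed
  have "(\<exists>x. \<phi> (v(i := x))) \<longleftrightarrow> (\<exists>\<tau>\<in>T. \<phi> (v(i := \<tau> v)))" for v
  proof
    assume "\<exists>x. \<phi> (v(i := x))"
    then obtain x where x: "\<phi> (v(i := x))" ..
    have roots: "z \<in> (\<lambda>z. z v) ` Z0" if "p \<in> (\<lambda>P. P v) ` F" "p \<noteq> 0" "poly p z = 0" for p z
      using that roots_inD[OF Z(3)] unfolding Z0_def by fastforce
    have Zv: "finite ((\<lambda>z. z v) ` Z0)" "(\<lambda>z. z v) ` Z0 \<noteq> {}" using Z0(1) by (auto simp: Z0_def)
    obtain z' w' y where "z' \<in> (\<lambda>z. z v) ` Z0" "w' \<in> (\<lambda>z. z v) ` Z0"
      and y: "y \<in> {z', z' + 1, z' - 1, (z' + w') * (1/2)}"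
      and s: "\<forall>p\<in>(\<lambda>P. P v) ` F. 0 < poly p x \<longleftrightarrow> 0 < poly p y"
      by (rule sign_equivalent_test_point[where \<P> = "(\<lambda>P. P v) ` F" and x = x, OF Zv])
        (rule roots that; assumption)+
    then obtain z w where zw: "z \<in> Z0" "w \<in> Z0" "z' = z v" "w' = w v" by auto
    then have "{z, \<lambda>v. z v + 1, \<lambda>v. z v - 1, \<lambda>v. (z v + w v) * (1/2)} \<subseteq> T" unfolding T_def by blast
    moreover have "y \<in> (\<lambda>\<tau>. \<tau> v) ` {z, \<lambda>v. z v + 1, \<lambda>v. z v - 1, \<lambda>v. (z v + w v) * (1/2)}"
      using y zw by auto
    ultimately have "y \<in> (\<lambda>\<tau>. \<tau> v) ` T" by (rule subsetD[OF image_mono])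
    then have "\<exists>\<tau>\<in>T. \<tau> v = y" by auto
    moreover have "\<phi> (v(i := y))" using F(3)[of v x y] s x by auto
    ultimately show "\<exists>\<tau>\<in>T. \<phi> (v(i := \<tau> v))" by blast
  qed blast
  \<comment> \<open>The test functions are in general not polynomials; conservativity of
    \<open>B\<close> brings the disjunction back.\<close>
  moreover have "constructible B (\<lambda>v. \<exists>\<tau>\<in>T. \<phi> (v(i := \<tau> v)))"
    using T by (intro constructible_bex constructible_fun_upd[OF \<phi>] B'(1,2)) auto
  ultimately show ?thesis using B'(3) by simp
qed

lemma constructible_ex_finite:
  assumes "finite J" "constructible polynomials \<phi>"
  shows "constructible polynomials (\<lambda>v. \<exists>w. (\<forall>i. i \<notin> J \<longrightarrow> w i = v i) \<and> \<phi> w)"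
  using assms(1)
proof induction
  case empty
  have "(\<exists>w. (\<forall>i. i \<notin> {} \<longrightarrow> w i = v i) \<and> \<phi> w) \<longleftrightarrow> \<phi> v" for v
    by (metis empty_iff ext)
  then show ?case using assms(2) by simp
next
  case (insert j J)
  have "(\<exists>w. (\<forall>i. i \<notin> insert j J \<longrightarrow> w i = v i) \<and> \<phi> w) \<longleftrightarrow>
     (\<exists>x. \<exists>w. (\<forall>i. i \<notin> J \<longrightarrow> w i = (v(j := x)) i) \<and> \<phi> w)" for v
    by (auto simp: fun_upd_def) (metis+)?
  then show ?case using constructible_ex_fun_upd[OF insert.IH, of j] by simp
qed

subsection \<open>Pareto values, tangency and dimension\<close>

lemma interior_nonneg_orthant: "interior nonneg_orthant = {v :: real ^ 'm. \<forall>i. 0 < v $ i}"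
proof (rule interior_unique)
  show "{v :: real ^ 'm. \<forall>i. 0 < v $ i} \<subseteq> nonneg_orthant"
    by (auto simp: nonneg_orthant_def less_imp_le)
  have "{v :: real ^ 'm. \<forall>i. 0 < v $ i} = (\<Inter>i\<in>UNIV. {v. 0 < v $ i})" by auto
  moreover have "open (\<Inter>i\<in>UNIV. {v :: real ^ 'm. 0 < v $ i})"
    by (intro open_INT) (auto intro: open_halfspace_component_gt_cart)
  ultimately show "open {v :: real ^ 'm. \<forall>i. 0 < v $ i}" by simp
next
  fix T :: "(real ^ 'm) set" assume T: "T \<subseteq> nonneg_orthant" "open T"
  show "T \<subseteq> {v. \<forall>i. 0 < v $ i}"
  proof (intro subsetI CollectI allI)
    fix v i assume "v \<in> T"
    then obtain e where e: "e > 0" "ball v e \<subseteq> T" using T(2) openE by blast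
    have "v - (e / 2) *\<^sub>R axis i 1 \<in> ball v e" using e by (simp add: dist_norm)
    then have "0 \<le> (v - (e / 2) *\<^sub>R axis i 1) $ i" using e T(1) unfolding nonneg_orthant_def by blast
    then show "0 < v $ i" using e by (simp add: axis_def)
  qed
qed

lemma weak_pareto_values_eq:
  "weak_pareto_values f = {t \<in> closure (range f). \<not> (\<exists>x. \<forall>i. f x $ i < t $ i)}"
proof -
  have "f x \<in> (\<lambda>v. t - v) ` interior nonneg_orthant \<longleftrightarrow> (\<forall>i. f x $ i < t $ i)" for x t
    unfolding interior_nonneg_orthant image_iff
  proof
    assume "\<forall>i. f x $ i < t $ i"
    then show "\<exists>v\<in>{v. \<forall>i. 0 < v $ i}. f x = t - v" by (intro bexI[of _ "t - f x"]) auto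
  qed auto
  then show ?thesis unfolding weak_pareto_values_def by auto
qed

lemma pareto_values_eq:
  "pareto_values f = {t \<in> closure (range f). \<not> (\<exists>x. (\<forall>i. f x $ i \<le> t $ i) \<and> (\<exists>i. f x $ i < t $ i))}"
proof -
  have "f x \<in> (\<lambda>v. t - v) ` (nonneg_orthant - {0}) \<longleftrightarrow>
      (\<forall>i. f x $ i \<le> t $ i) \<and> (\<exists>i. f x $ i < t $ i)" for x t
    unfolding image_iff nonneg_orthant_def
  proof
    assume *: "(\<forall>i. f x $ i \<le> t $ i) \<and> (\<exists>i. f x $ i < t $ i)"
    then have "t - f x \<noteq> 0" by auto
    then show "\<exists>v\<in>{v. \<forall>i. 0 \<le> v $ i} - {0}. f x = t - v"
      using * by (intro bexI[of _ "t - f x"]) auto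
  next
    assume "\<exists>v\<in>{v. \<forall>i. 0 \<le> v $ i} - {0}. f x = t - v"
    then obtain v where v: "\<forall>i. 0 \<le> v $ i" "v \<noteq> 0" "f x = t - v" by auto
    then obtain i where "v $ i \<noteq> 0" by (auto simp: vec_eq_iff)
    then show "(\<forall>i. f x $ i \<le> t $ i) \<and> (\<exists>i. f x $ i < t $ i)" using v by (auto simp: order_less_le)
  qed
  then show ?thesis unfolding pareto_values_def by auto
qed

lemma pareto_subset_weak_pareto: "pareto_values f \<subseteq> weak_pareto_values f"
  unfolding pareto_values_eq weak_pareto_values_eq by (blast intro: less_imp_le)

section \<open>Empty interior and the dimension bound\<close>

lemma interior_weak_pareto_values:
  fixes f :: "'a \<Rightarrow> real ^ 'm"
  shows "interior (weak_pareto_values f) = {}"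
proof (rule ccontr)
  assume "interior (weak_pareto_values f) \<noteq> {}"
  then obtain t e where e: "e > 0" "ball t e \<subseteq> weak_pareto_values f"
    by (metis ex_in_conv mem_interior)
  define c :: "real ^ 'm" where "c = (\<chi> i. 1)"
  have "c \<noteq> 0" by (simp add: c_def vec_eq_iff)
  \<comment> \<open>Half the radius keeps \<open>s\<close> in the ball. A value of \<open>f\<close>
    nearer to \<open>t\<close> than this factor lies below \<open>s\<close> in each component, since
    all components of \<open>c\<close> are 1.\<close>
  define s where "s = t + (e / (2 * norm c)) *\<^sub>R c"
  have d: "e / (2 * norm c) > 0" using e \<open>c \<noteq> 0\<close> by simp
  have "s \<in> ball t e" using e \<open>c \<noteq> 0\<close> by (simp add: s_def dist_norm)
  then have s: "s \<in> weak_pareto_values f" and t: "t \<in> weak_pareto_values f" using e by auto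
  obtain x where x: "dist (f x) t < e / (2 * norm c)"
    using t d unfolding weak_pareto_values_eq closure_approachable by blast
  have "f x $ i < s $ i" for i
    using x component_le_norm_cart[of "f x - t" i] by (simp add: s_def c_def dist_norm)
  then show False using s unfolding weak_pareto_values_eq by blast
qed

text \<open>If \<open>d\<close> were the full dimension, \<open>L\<close> would be the whole space.
  The chart would then force its domain \<open>U\<close> into \<open>M\<close>, giving an interior
  point.\<close>

lemma submanifold_full_dim_interior:
  fixes M :: "'a::euclidean_space set"
  assumes "Cp_submanifold p d M" "interior M = {}" "M \<noteq> {}"
  shows "d < DIM('a)"
proof -
  obtain x where "x \<in> M" using assms(3) by blast
  then obtain U V and \<phi> \<psi> :: "'a \<Rightarrow> 'a" and L where *: "open U" "x \<in> U" "homeomorphism U V \<phi> \<psi>"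
    "subspace L" "dim L = d" "\<phi> ` (M \<inter> U) = V \<inter> L"
    using assms(1)[unfolded Cp_submanifold_def, rule_format, OF \<open>x \<in> M\<close>]
    by (elim exE conjE) (rule that; assumption)
  have "d \<noteq> DIM('a)"
  proof
    assume "d = DIM('a)"
    with * have "L = UNIV" by (metis dim_eq_full span_eq_iff)
    then have "\<phi> ` (M \<inter> U) = \<phi> ` U" using * by (simp add: homeomorphism_image1)
    moreover have "inj_on \<phi> U" using *(3) by (metis homeomorphism_def inj_on_inverseI)
    ultimately have "U \<subseteq> M" by (metis Int_lower1 Int_lower2 inj_on_image_eq_iff order_refl)
    then have "x \<in> interior M" using * by (meson interior_maximal subsetD)
    then show False using assms(2) by simp
  qed
  moreover have "d \<le> DIM('a)" using * dim_subset_UNIV by blast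
  ultimately show ?thesis by simp
qed

lemma semialgebraic_dim_le:
  fixes S :: "'a::euclidean_space set"
  assumes "interior S = {}"
  shows "semialgebraic_dim p S \<le> ereal (real DIM('a) - 1)"
  unfolding semialgebraic_dim_def
proof (rule Sup_least, clarify)
  fix d M \<M> assume "semialgebraic_decomposition p S \<M>" "M \<in> \<M>" and M: "Cp_submanifold p d M"
  then have "M \<subseteq> S" "M \<noteq> {}"
    unfolding semialgebraic_decomposition_def partition_on_def by auto
  moreover from this have "interior M = {}" using interior_mono[of M S] assms by simp
  ultimately have "d < DIM('a)"
    using submanifold_full_dim_interior[OF M] by blast
  then show "ereal (real d) \<le> ereal (real DIM('a) - 1)" by simp
qed

section \<open>Gradients and minima on spheres\<close>

lemma gradient_eq:
  assumes "GDERIV g x :> D"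
  shows "gradient g x = D"
  unfolding gradient_def
proof (rule the_equality)
  show "GDERIV g x :> D" by fact
  fix E assume "GDERIV g x :> E"
  then have "(\<lambda>h. h \<bullet> E) = (\<lambda>h. h \<bullet> D)"
    using assms unfolding gderiv_def by (rule has_derivative_unique)
  then have "(E - D) \<bullet> E = (E - D) \<bullet> D" by meson
  then have "(E - D) \<bullet> (E - D) = 0" by (simp add: inner_diff_right)
  then show "E = D" by simp
qed

lemma GDERIV_gradient:
  fixes g :: "'a::euclidean_space \<Rightarrow> real"
  assumes "g differentiable (at x)"
  shows "GDERIV g x :> gradient g x"
proof -
  obtain g' where g': "(g has_derivative g') (at x)" using assms unfolding differentiable_def by blast
  then interpret linear g' using has_derivative_linear by blast
  have "GDERIV g x :> adjoint g' 1"
    using g' adjoint_works[OF linear_axioms, of _ 1] by (simp add: gderiv_def)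
  then show ?thesis using gradient_eq by metis
qed

text \<open>The component \<open>v\<close> of \<open>G\<close> orthogonal to \<open>y\<close>
  vanishes. Otherwise the great circle \<open>c\<close> through \<open>y\<close> in the direction of
  \<open>v\<close> stays on the sphere, and the derivative of \<open>g\<close> along it at the
  minimum is a positive multiple of \<open>v \<bullet> v\<close>.\<close>

lemma lagrange_sphere:
  fixes G :: "'a::real_inner"
  assumes "GDERIV g y :> G" and R: "norm y = R" "R > 0"
    and min: "\<And>x. norm x = R \<Longrightarrow> g y \<le> g x"
  obtains \<mu> where "G + \<mu> *\<^sub>R y = 0"
proof -
  define v where "v = G - (G \<bullet> y / R\<^sup>2) *\<^sub>R y"
  have yy: "y \<bullet> y = R\<^sup>2" using R by (simp add: power2_norm_eq_inner[symmetric])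
  have vy: "v \<bullet> y = 0" using R by (simp add: v_def inner_diff_left yy)
  have "v = 0"
  proof (rule ccontr)
    assume "v \<noteq> 0"
    define w where "w = (R / norm v) *\<^sub>R v"
    have w: "w \<bullet> y = 0" "y \<bullet> w = 0" "w \<bullet> w = R\<^sup>2"
      using vy \<open>v \<noteq> 0\<close>
      by (auto simp: w_def inner_commute power2_eq_square norm_eq_sqrt_inner)
    define c where "c = (\<lambda>s. cos s *\<^sub>R y + sin s *\<^sub>R w)"
    have "norm (c s) = R" for s
    proof -
      have "c s \<bullet> c s = (cos s)\<^sup>2 * R\<^sup>2 + (sin s)\<^sup>2 * R\<^sup>2"
        by (simp add: c_def inner_add_left inner_add_right w yy power2_eq_square)
      also have "\<dots> = R\<^sup>2" by (simp add: distrib_right[symmetric])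
      finally show ?thesis using R(2) by (simp add: norm_eq_sqrt_inner)
    qed
    moreover have "(c has_derivative (\<lambda>h. h *\<^sub>R w)) (at 0)"
      unfolding c_def by (auto intro!: derivative_eq_intros)
    then have "((\<lambda>s. g (c s)) has_derivative (\<lambda>h. (h *\<^sub>R w) \<bullet> G)) (at 0)"
      using assms(1) unfolding gderiv_def
      by (intro has_derivative_compose[of c _ 0 UNIV g]) (auto simp: c_def)
    then have "((\<lambda>s. g (c s)) has_real_derivative w \<bullet> G) (at 0)"
      by (simp add: has_field_derivative_def mult.commute[of _ "w \<bullet> G"])
    ultimately have "w \<bullet> G = 0"
      using DERIV_local_min[of "\<lambda>s. g (c s)" "w \<bullet> G" 0 1] min by (simp add: c_def)
    then have "v \<bullet> G = 0" using \<open>v \<noteq> 0\<close> R by (simp add: w_def)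
    then have "v \<bullet> v = 0" using vy by (simp add: v_def inner_diff_right)
    then show False using \<open>v \<noteq> 0\<close> by simp
  qed
  then have "G + (- (G \<bullet> y / R\<^sup>2)) *\<^sub>R y = 0" by (simp add: v_def)
  then show ?thesis by (rule that)
qed

section \<open>Attained and non-attained weak Pareto values\<close>

lemma attained_weak_pareto_critical:
  fixes f :: "real ^ 'n \<Rightarrow> real ^ 'm"
  assumes diff: "\<And>x. f differentiable (at x)" and t: "t \<in> weak_pareto_values f" "t \<in> range f"
  shows "t \<in> critical_values f"
proof (rule ccontr)
  assume "t \<notin> critical_values f"
  with t obtain x where x: "f x = t" "surj (frechet_derivative f (at x))"
    unfolding critical_values_def by blast
  define f' where "f' = frechet_derivative f (at x)"
  have f': "(f has_derivative f') (at x)"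
    unfolding f'_def using diff frechet_derivative_works by blast
  then obtain g' where "linear g'" "f' \<circ> g' = id"
    using linear_surjective_right_inverse[of f'] has_derivative_linear x(2) f'_def by blast
  moreover have "continuous_on UNIV f"
    using diff by (simp add: continuous_at_imp_continuous_on differentiable_imp_continuous_within)
  \<comment> \<open>Sussmann's open mapping theorem combines continuity of \<open>f\<close> with a
    right inverse of the derivative at this one point.\<close>
  ultimately have "f x \<in> interior (range f)"
    using sussmann_open_mapping[of UNIV f x f' g' UNIV] f' linear_conv_bounded_linear by auto
  then obtain e where e: "e > 0" "ball t e \<subseteq> range f" by (metis mem_interior x(1))
  define c :: "real ^ 'm" where "c = (\<chi> i. 1)"
  have "c \<noteq> 0" by (simp add: c_def vec_eq_iff)
  have d: "e / (2 * norm c) > 0" using e \<open>c \<noteq> 0\<close> by simp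
  have "t - (e / (2 * norm c)) *\<^sub>R c \<in> ball t e" using e \<open>c \<noteq> 0\<close> by (simp add: dist_norm)
  then obtain z where "f z = t - (e / (2 * norm c)) *\<^sub>R c" using e by (metis imageE subsetD)
  then have "\<forall>i. f z $ i < t $ i" using d by (simp add: c_def)
  then show False using t unfolding weak_pareto_values_eq by blast
qed

text \<open>
  The squared distance to \<open>t\<close>, minimised over a sphere, has its minimisers in the tangency variety; the
  multipliers are the components of \<open>f y - t\<close>, which do not all vanish because \<open>t\<close> is not attained.
\<close>
lemma nonattained_closure_tangency:
  fixes f :: "real ^ 'n \<Rightarrow> real ^ 'm"
  assumes diff: "\<And>x. f differentiable (at x)" and t: "t \<in> closure (range f)" "t \<notin> range f"
  shows "t \<in> tangency_values_at_infinity f"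
proof -
  have cont: "continuous_on S f" for S
    using diff by (simp add: continuous_at_imp_continuous_on differentiable_imp_continuous_within)
  have "\<exists>y\<in>tangency_variety f. real k < norm y \<and> dist (f y) t < 1 / Suc k" for k
  proof -
    \<comment> \<open>The compact image of the ball misses \<open>t\<close> and keeps a distance
      \<open>e\<close> from it, so values closer than \<open>e\<close> come from outside the
      ball.\<close>
    have "closed (f ` cball 0 (real k))"
      by (intro compact_imp_closed compact_continuous_image cont compact_cball)
    moreover have "t \<notin> f ` cball 0 (real k)" using t(2) by blast
    ultimately obtain e where e: "e > 0" "\<forall>y\<in>f ` cball 0 (real k). e \<le> dist t y"
      using separate_point_closed by metis
    have "min e (1 / Suc k) > 0" using e by simp
    then obtain x where x: "dist (f x) t < min e (1 / Suc k)"
      using t(1) unfolding closure_approachable by blast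
    have xk: "norm x > k"
    proof (rule ccontr)
      assume "\<not> ?thesis"
      then have "f x \<in> f ` cball 0 (real k)" by simp
      then show False using e(2) x by (force simp: dist_commute)
    qed
    \<comment> \<open>On the sphere through \<open>x\<close>, a minimiser has a value at least as
      close to \<open>t\<close> as \<open>f x\<close> and still has norm above
      \<open>k\<close>.\<close>
    define R where "R = norm x"
    have R: "R > 0" using xk unfolding R_def by linarith
    define g where "g y = (\<Sum>i\<in>UNIV. (f y $ i - t $ i)\<^sup>2)" for y
    have g: "g y = (dist (f y) t)\<^sup>2" for y
      unfolding g_def dist_norm power2_norm_eq_inner inner_vec_def by (simp add: power2_eq_square)
    have "continuous_on (sphere 0 R) g"
      unfolding g by (intro continuous_intros cont)
    moreover have "x \<in> sphere 0 R" by (simp add: R_def)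
    ultimately obtain y where y: "y \<in> sphere 0 R" "\<And>z. z \<in> sphere 0 R \<Longrightarrow> g y \<le> g z"
      using continuous_attains_inf[of "sphere 0 R" g] by (metis compact_sphere empty_iff)
    define G where "G = (\<Sum>i\<in>UNIV. (2 * (f y $ i - t $ i)) *\<^sub>R gradient (\<lambda>y. f y $ i) y)"
    have fi: "GDERIV (\<lambda>y. f y $ i) y :> gradient (\<lambda>y. f y $ i) y" for i
      using diff[of y] unfolding differentiable_def
      by (intro GDERIV_gradient)
        (auto simp: differentiable_def dest: bounded_linear.has_derivative[OF bounded_linear_vec_nth])
    have "GDERIV g y :> G"
      unfolding g_def[abs_def] G_def gderiv_def inner_sum_right
      using fi unfolding gderiv_def
      by (auto intro!: derivative_eq_intros simp: algebra_simps)
    then obtain \<mu> where mu: "G + \<mu> *\<^sub>R y = 0"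
      using lagrange_sphere[of g y G R] y R by auto
    have "f y \<noteq> t" using t(2) by blast
    then obtain j where "f y $ j - t $ j \<noteq> 0" by (auto simp: vec_eq_iff)
    then have "y \<in> tangency_variety f"
      unfolding tangency_variety_def
      by (intro CollectI exI[of _ "\<lambda>i. 2 * (f y $ i - t $ i)"] exI[of _ \<mu>]) (use mu in \<open>auto simp: G_def\<close>)
    moreover have "dist (f y) t \<le> dist (f x) t"
      using y(2)[OF \<open>x \<in> sphere 0 R\<close>] unfolding g by (rule power2_le_imp_le) simp
    ultimately show ?thesis using x xk y(1) by (intro bexI[of _ y]) (auto simp: R_def)
  qed
  then obtain xs where xs: "\<And>k. xs k \<in> tangency_variety f" "\<And>k. real k < norm (xs k)"
    "\<And>k. dist (f (xs k)) t < 1 / Suc k" by metis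
  have "filterlim (\<lambda>k. norm (xs k)) at_top sequentially"
    by (rule filterlim_at_top_mono[OF filterlim_real_sequentially]) (simp add: less_imp_le xs(2))
  moreover have "(\<lambda>k. f (xs k)) \<longlonglongrightarrow> t"
  proof (rule metric_tendsto_imp_tendsto[OF LIMSEQ_inverse_real_of_nat], rule always_eventually, rule allI)
    fix k show "dist (f (xs k)) t \<le> dist (inverse (real (Suc k))) 0"
      using xs(3)[of k] by (simp add: inverse_eq_divide)
  qed
  ultimately show ?thesis
    unfolding tangency_values_at_infinity_def using xs(1) by blast
qed

subsection \<open>Semi-algebraic sets\<close>

lemma basic_semialgebraicE:
  assumes "basic_semialgebraic S"
  obtains P Q where "finite P" "finite Q" "\<forall>g\<in>P \<union> Q. real_polynomial_function g"
    "S = {x. (\<forall>g\<in>P. g x = 0) \<and> (\<forall>g\<in>Q. g x > 0)}"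
  using assms unfolding basic_semialgebraic_def by (elim exE conjE) (rule that; assumption)

lemma basic_semialgebraic_Int:
  assumes "basic_semialgebraic S" "basic_semialgebraic T"
  shows "basic_semialgebraic (S \<inter> T)"
proof -
  obtain P Q where 1: "finite P" "finite Q" "\<forall>g\<in>P \<union> Q. real_polynomial_function g"
    "S = {x. (\<forall>g\<in>P. g x = 0) \<and> (\<forall>g\<in>Q. g x > 0)}"
    using assms(1) by (rule basic_semialgebraicE)
  obtain P' Q' where 2: "finite P'" "finite Q'" "\<forall>g\<in>P' \<union> Q'. real_polynomial_function g"
    "T = {x. (\<forall>g\<in>P'. g x = 0) \<and> (\<forall>g\<in>Q'. g x > 0)}"
    using assms(2) by (rule basic_semialgebraicE)
  have 3: "S \<inter> T = {x. (\<forall>g\<in>P \<union> P'. g x = 0) \<and> (\<forall>g\<in>Q \<union> Q'. g x > 0)}"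
    unfolding 1(4) 2(4) by blast
  have 4: "\<forall>g\<in>(P \<union> P') \<union> (Q \<union> Q'). real_polynomial_function g" using 1(3) 2(3) by blast
  show ?thesis
    unfolding basic_semialgebraic_def
    by (intro exI[of _ "P \<union> P'"] exI[of _ "Q \<union> Q'"] conjI finite_UnI 1(1,2) 2(1,2) 3 4)
qed

lemma basic_imp_semialgebraic: "basic_semialgebraic S \<Longrightarrow> semialgebraic S"
  unfolding semialgebraic_def by (rule exI[of _ "{S}"]) auto

lemma semialgebraic_Int:
  assumes "semialgebraic S" "semialgebraic T"
  shows "semialgebraic (S \<inter> T)"
proof -
  from assms obtain \<F> \<G> where FG: "finite \<F>" "\<forall>B\<in>\<F>. basic_semialgebraic B" "S = \<Union>\<F>"
    "finite \<G>" "\<forall>B\<in>\<G>. basic_semialgebraic B" "T = \<Union>\<G>"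
    unfolding semialgebraic_def by metis
  have "S \<inter> T = \<Union>((\<lambda>(A, B). A \<inter> B) ` (\<F> \<times> \<G>))"
    unfolding FG by auto
  then show ?thesis
    unfolding semialgebraic_def using FG
    by (intro exI[of _ "(\<lambda>(A, B). A \<inter> B) ` (\<F> \<times> \<G>)"]) (auto intro: basic_semialgebraic_Int)
qed

lemma semialgebraic_Un:
  assumes "semialgebraic S" "semialgebraic T"
  shows "semialgebraic (S \<union> T)"
proof -
  from assms obtain \<F> \<G> where FG: "finite \<F>" "\<forall>B\<in>\<F>. basic_semialgebraic B" "S = \<Union>\<F>"
    "finite \<G>" "\<forall>B\<in>\<G>. basic_semialgebraic B" "T = \<Union>\<G>"
    unfolding semialgebraic_def by metis
  then show ?thesis
    unfolding semialgebraic_def by (intro exI[of _ "\<F> \<union> \<G>"]) auto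
qed

lemma semialgebraic_empty: "semialgebraic {}"
  unfolding semialgebraic_def by (rule exI[of _ "{}"]) auto

lemma semialgebraic_UNIV: "semialgebraic UNIV"
  by (rule basic_imp_semialgebraic, unfold basic_semialgebraic_def)
    (intro exI[of _ "{}"], auto)

lemma semialgebraic_UN:
  assumes "finite I" "\<And>i. i \<in> I \<Longrightarrow> semialgebraic (S i)"
  shows "semialgebraic (\<Union>i\<in>I. S i)"
  using assms by (induction I) (auto intro: semialgebraic_empty semialgebraic_Un)

lemma semialgebraic_INT:
  assumes "finite I" "\<And>i. i \<in> I \<Longrightarrow> semialgebraic (S i)"
  shows "semialgebraic (\<Inter>i\<in>I. S i)"
  using assms by (induction I) (auto intro: semialgebraic_UNIV semialgebraic_Int)

lemma semialgebraic_pos: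
  assumes "real_polynomial_function g" shows "semialgebraic {x. g x > 0}"
  by (rule basic_imp_semialgebraic, unfold basic_semialgebraic_def)
    (intro exI[of _ "{}"] exI[of _ "{g}"], use assms in auto)

lemma semialgebraic_zero:
  assumes "real_polynomial_function g" shows "semialgebraic {x. g x = 0}"
  by (rule basic_imp_semialgebraic, unfold basic_semialgebraic_def)
    (intro exI[of _ "{g}"] exI[of _ "{}"], use assms in auto)

lemma semialgebraic_neg:
  assumes "real_polynomial_function g" shows "semialgebraic {x. g x < 0}"
  using semialgebraic_pos[OF real_polynomial_function_minus[OF assms]] by simp

lemma semialgebraic_Compl:
  assumes "semialgebraic S"
  shows "semialgebraic (- S)"
proof -
  from assms obtain \<F> where F: "finite \<F>" "\<forall>B\<in>\<F>. basic_semialgebraic B" "S = \<Union>\<F>"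
    unfolding semialgebraic_def by metis
  have "semialgebraic (- B)" if BF: "B \<in> \<F>" for B
  proof -
    obtain P Q where B: "finite P" "finite Q" "\<forall>g\<in>P \<union> Q. real_polynomial_function g"
      "B = {x. (\<forall>g\<in>P. g x = 0) \<and> (\<forall>g\<in>Q. g x > 0)}"
      using F(2)[rule_format, OF BF] by (rule basic_semialgebraicE)
    have "- B = (\<Union>g\<in>P. {x. g x > 0} \<union> {x. g x < 0}) \<union> (\<Union>g\<in>Q. {x. g x = 0} \<union> {x. g x < 0})"
      unfolding B(4) by (auto simp: not_less order_le_less)
    also have "semialgebraic \<dots>"
      using B(1-3) by (intro semialgebraic_Un semialgebraic_UN semialgebraic_pos semialgebraic_neg semialgebraic_zero) auto
    finally show ?thesis .
  qed
  then have "semialgebraic (\<Inter>B\<in>\<F>. - B)" using F(1) by (intro semialgebraic_INT)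
  moreover have "(\<Inter>B\<in>\<F>. - B) = - S" unfolding F(3) by auto
  ultimately show ?thesis by simp
qed

section \<open>From polynomial conditions to semi-algebraic sets\<close>

lemma constructible_imp_semialgebraic:
  fixes e :: "'a::euclidean_space \<Rightarrow> 'i \<Rightarrow> real"
  assumes "constructible polynomials \<phi>" and e: "\<And>i. real_polynomial_function (\<lambda>t. e t i)"
  shows "semialgebraic {t. \<phi> (e t)}"
  using assms(1)
proof induction
  case (pos g)
  then have "real_polynomial_function (\<lambda>t. g (e t))"
    by induction (auto intro: real_polynomial_function.intros e)
  then show ?case by (rule semialgebraic_pos)
next
  case (neg \<phi>)
  then show ?case using semialgebraic_Compl[of "{t. \<phi> (e t)}"] by (simp add: Collect_neg_eq)
next
  case (conj \<phi> \<psi>)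
  then show ?case using semialgebraic_Int[of "{t. \<phi> (e t)}" "{t. \<psi> (e t)}"] by (simp add: Collect_conj_eq)
qed

lemma real_polynomial_function_polynomials:
  fixes g :: "real ^ 'n \<Rightarrow> real"
  assumes "real_polynomial_function g"
  shows "(\<lambda>v. g (\<chi> j. v (r j))) \<in> polynomials"
  using assms
proof induction
  case (linear h)
  then interpret bounded_linear h .
  \<comment> \<open>Expansion in the standard basis writes a linear functional as a combination of
    the variables \<open>v (r j)\<close>.\<close>
  have "h (\<chi> j. v (r j)) = (\<Sum>j\<in>UNIV. v (r j) * h (axis j 1))" for v :: "'a \<Rightarrow> real"
  proof -
    have "(\<chi> j. v (r j)) = (\<Sum>j\<in>UNIV. v (r j) *\<^sub>R axis j (1::real))"
      using basis_expansion[of "\<chi> j. v (r j)"] by (simp add: scalar_mult_eq_scaleR)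
    then show ?thesis by (simp add: sum scaleR)
  qed
  then show ?case
    by (simp, intro fun_algebra_sum fun_algebra_polynomials polynomials.intros finite)
qed (auto intro: polynomials.intros)

text \<open>
  The variables of the formulas are the components of the value \<open>t\<close> and of the point \<open>x\<close>, and in addition \<open>None\<close>
  for the radius in the description of the closure.
\<close>
definition t_part :: "(('m + 'n) option \<Rightarrow> real) \<Rightarrow> real ^ 'm" where
  "t_part v = (\<chi> i. v (Some (Inl i)))"

definition x_part :: "(('m + 'n) option \<Rightarrow> real) \<Rightarrow> real ^ 'n" where
  "x_part v = (\<chi> j. v (Some (Inr j)))"

text \<open>Changing an assignment only at the variables \<open>Some (Inr j)\<close> amounts to
  choosing a new point \<open>x\<close> with radius and value kept, so this finite block can be
  eliminated.\<close>

lemma constructible_ex_x_part: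
  fixes \<Psi> :: "real \<Rightarrow> real ^ 'm \<Rightarrow> real ^ 'n \<Rightarrow> bool"
  assumes "constructible polynomials (\<lambda>v. \<Psi> (v None) (t_part v) (x_part v))"
  shows "constructible polynomials (\<lambda>v :: ('m + 'n) option \<Rightarrow> real. \<exists>x. \<Psi> (v None) (t_part v) x)"
proof -
  let ?J = "range (\<lambda>j. Some (Inr j)) :: ('m + 'n) option set"
  have "(\<exists>w. (\<forall>i. i \<notin> ?J \<longrightarrow> w i = v i) \<and> \<Psi> (w None) (t_part w) (x_part w)) \<longleftrightarrow>
      (\<exists>x. \<Psi> (v None) (t_part v) x)" for v :: "('m + 'n) option \<Rightarrow> real"
  proof
    assume "\<exists>w. (\<forall>i. i \<notin> ?J \<longrightarrow> w i = v i) \<and> \<Psi> (w None) (t_part w) (x_part w)"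
    then obtain w where w: "\<And>i. i \<notin> ?J \<Longrightarrow> w i = v i" "\<Psi> (w None) (t_part w) (x_part w)" by blast
    have "w None = v None" "t_part w = t_part v" using w(1) by (auto simp: t_part_def vec_eq_iff)
    then show "\<exists>x. \<Psi> (v None) (t_part v) x" using w(2) by auto
  next
    assume "\<exists>x. \<Psi> (v None) (t_part v) x"
    then obtain x where x: "\<Psi> (v None) (t_part v) x" ..
    define w where "w = (\<lambda>i. case i of Some (Inr j) \<Rightarrow> x $ j | _ \<Rightarrow> v i)"
    have "w None = v None" "t_part w = t_part v" "x_part w = x"
      by (auto simp: w_def t_part_def x_part_def vec_eq_iff)
    moreover have "\<forall>i. i \<notin> ?J \<longrightarrow> w i = v i"
      unfolding w_def by (auto split: option.split sum.split)
    ultimately show "\<exists>w. (\<forall>i. i \<notin> ?J \<longrightarrow> w i = v i) \<and> \<Psi> (w None) (t_part w) (x_part w)"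
      using x by metis
  qed
  moreover have "finite ?J" by simp
  ultimately show ?thesis using constructible_ex_finite[OF _ assms, of ?J] by simp
qed

lemma real_polynomial_function_component:
  assumes "polynomial_function f"
  shows "real_polynomial_function (\<lambda>x. f x $ i)"
  using assms bounded_linear_vec_nth[of i] unfolding polynomial_function_def o_def by blast

text \<open>Squaring makes the distance condition polynomial; \<open>0 < e\<close> restores what
  \<open>e * e\<close> forgets about the sign of \<open>e\<close>.\<close>

lemma dist_less_iff_sum:
  fixes y t :: "real ^ 'm"
  shows "dist y t < e \<longleftrightarrow> 0 < e \<and> (\<Sum>i\<in>UNIV. (y $ i - t $ i) * (y $ i - t $ i)) < e * e"
  unfolding dist_norm norm_lt_square by (simp add: inner_vec_def power2_eq_square)

lemma semialgebraic_pareto: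
  fixes f :: "real ^ 'n \<Rightarrow> real ^ 'm"
  assumes "polynomial_function f"
  shows "semialgebraic (pareto_values f)" "semialgebraic (weak_pareto_values f)"
proof -
  let ?A = "polynomials :: ((('m + 'n) option \<Rightarrow> real) \<Rightarrow> real) set"
  note A = fun_algebra_polynomials
  have f: "(\<lambda>v. f (x_part v) $ i) \<in> ?A" for i
    unfolding x_part_def
    by (rule real_polynomial_function_polynomials[OF real_polynomial_function_component[OF assms]])
  have t: "(\<lambda>v. t_part v $ i) \<in> ?A" for i
    unfolding t_part_def by (simp add: polynomials.var)
  have e: "(\<lambda>v. v None) \<in> ?A" by (rule polynomials.var)
  have "constructible ?A (\<lambda>v. 0 < v None \<longrightarrow> (\<exists>x. dist (f x) (t_part v) < v None))"
    unfolding dist_less_iff_sum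
    by (intro constructible_imp constructible_ex_x_part constructible.conj constructible_less A
      fun_algebraD(1) fun_algebra_sum fun_algebraD(3) fun_algebra_diff f t e finite)
  \<comment> \<open>The universal quantifier over the radius is treated as a negated existential one
    over the variable \<open>None\<close>.\<close>
  from constructible.neg[OF constructible_ex_fun_upd[OF constructible.neg[OF this], of None]]
  have "constructible ?A (\<lambda>v. \<forall>e>0. \<exists>x. dist (f x) (t_part (v(None := e))) < e)"
    by simp
  moreover have "t_part (v(None := e)) = t_part v" for v :: "('m + 'n) option \<Rightarrow> real" and e
    by (simp add: t_part_def)
  ultimately have cl: "constructible ?A (\<lambda>v. t_part v \<in> closure (range f))"
    by (simp add: closure_approachable)
  have "constructible ?A (\<lambda>v. \<exists>x. (\<forall>i\<in>UNIV. f x $ i \<le> t_part v $ i) \<and> (\<exists>i\<in>UNIV. f x $ i < t_part v $ i))"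
    by (intro constructible_ex_x_part constructible_intros A f t finite)
  then have P: "constructible ?A (\<lambda>v. t_part v \<in> pareto_values f)"
    unfolding pareto_values_eq mem_Collect_eq by (intro constructible.conj cl constructible.neg) simp
  have "constructible ?A (\<lambda>v. \<exists>x. \<forall>i\<in>UNIV. f x $ i < t_part v $ i)"
    by (intro constructible_ex_x_part constructible_intros A f t finite)
  then have W: "constructible ?A (\<lambda>v. t_part v \<in> weak_pareto_values f)"
    unfolding weak_pareto_values_eq mem_Collect_eq by (intro constructible.conj cl constructible.neg) simp
  \<comment> \<open>\<open>emb\<close> puts 0 for the radius and the point, on which the two
    conditions \<open>P\<close> and \<open>W\<close> do not depend.\<close>
  define emb :: "real ^ 'm \<Rightarrow> ('m + 'n) option \<Rightarrow> real"
    where "emb s = (\<lambda>i. case i of Some (Inl i) \<Rightarrow> s $ i | _ \<Rightarrow> 0)" for s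
  have emb: "real_polynomial_function (\<lambda>s. emb s i)" for i
  proof (cases i)
    case None
    then show ?thesis by (simp add: emb_def real_polynomial_function.intros)
  next
    case (Some k)
    then show ?thesis
      by (cases k) (auto simp: emb_def intro: real_polynomial_function.intros bounded_linear_vec_nth)
  qed
  have "t_part (emb s) = s" for s by (simp add: t_part_def emb_def vec_eq_iff)
  then show "semialgebraic (pareto_values f)" "semialgebraic (weak_pareto_values f)"
    using constructible_imp_semialgebraic[where e = emb, OF P emb]
      constructible_imp_semialgebraic[where e = emb, OF W emb] by simp_all
qed

theorem theorem3p1:
  fixes f :: "real ^ 'n \<Rightarrow> real ^ 'm" and p :: nat
  assumes "polynomial_function f" and "p \<ge> 1"
  shows "pareto_values f \<subseteq> weak_pareto_values f \<and>
         weak_pareto_values f \<subseteq> critical_values f \<union> tangency_values_at_infinity f \<and>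
         semialgebraic (pareto_values f) \<and>
         semialgebraic (weak_pareto_values f) \<and>
         semialgebraic_dim p (pareto_values f) \<le> ereal (real CARD('m) - 1) \<and>
         semialgebraic_dim p (weak_pareto_values f) \<le> ereal (real CARD('m) - 1)"
proof -
  have diff: "f differentiable (at x)" for x
    by (rule differentiable_at_polynomial_function[OF assms(1)])
  \<comment> \<open>The two lemmas split the weak Pareto values into attained and non-attained
    ones.\<close>
  have "weak_pareto_values f \<subseteq> critical_values f \<union> tangency_values_at_infinity f"
    using attained_weak_pareto_critical[OF diff] nonattained_closure_tangency[OF diff]
    unfolding weak_pareto_values_eq by blast
  moreover have "interior (pareto_values f) = {}"
    using interior_mono[OF pareto_subset_weak_pareto[of f]] interior_weak_pareto_values[of f] by simp
  ultimately show ?thesis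
    using pareto_subset_weak_pareto[of f] semialgebraic_pareto[OF assms(1)]
      semialgebraic_dim_le[of "pareto_values f" p]
      semialgebraic_dim_le[OF interior_weak_pareto_values[of f], of p] by simp
qed

end
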